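(* Fix $\theta>0$. If $C^{(n)}$ is distributed as the cycle counts of an ESF$(\theta)$ random permutation of $[n]$, then \[\sup_{x\in\mathbb{R}}\left|\mathbb{P}\!\left(\frac{\log\mathsf{invol}_n(C^{(n)})-\frac{\theta}{2}\log^2 n}{\sqrt{\frac{\theta}{3}\log^3 n}}\le x\right)-\Phi(x)\right|=O\!\left(\frac{1}{\sqrt{\log n}}\right),\] where $\Phi$ is the standard normal distribution function.
   Context: ESF$(\theta)$ is the Ewens measure on $\mathfrak{S}_n$: $\mathbb{P}(\sigma=\sigma_0)=\theta^{K(\sigma_0)}/\theta^{(n)}$, with $K$ the number of cycles and $\theta^{(n)}=\theta(\theta+1)\cdots(\theta+n-1)$; cycle counts $c_k$ = number of cycles of length $k$. For nonnegative integer vector $a$: $\mathsf{invol}_n(a)=\prod_{k=1}^n k^{a_k}\sum_{j=0}^{\lfloor a_k/2\rfloor}\frac{(a_k)_{2j}}{(2k)^j j!}$ with $(x)_r=x(x-1)\cdots(x-r+1)$; for cycle counts of $\sigma$ this equals the number of ordered pairs of involutions $(\tau_1,\tau_2)$ in $\mathfrak{S}_n$ with $\sigma=\tau_2\circ\tau_1$. *)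

theory Defs
  imports "HOL-Probability.Probability" "HOL-Combinatorics.Permutations" "HOL-Library.Landau_Symbols"
begin

definition perm_orbit :: "(nat \<Rightarrow> nat) \<Rightarrow> nat \<Rightarrow> nat set" where
  "perm_orbit \<sigma> x = {(\<sigma> ^^ j) x | j. True}"

definition perm_cycles :: "nat \<Rightarrow> (nat \<Rightarrow> nat) \<Rightarrow> nat set set" where
  "perm_cycles n \<sigma> = perm_orbit \<sigma> ` {1..n}"

definition num_cycles :: "nat \<Rightarrow> (nat \<Rightarrow> nat) \<Rightarrow> nat" where
  "num_cycles n \<sigma> = card (perm_cycles n \<sigma>)"

definition cycle_count :: "nat \<Rightarrow> (nat \<Rightarrow> nat) \<Rightarrow> nat \<Rightarrow> nat" where
  "cycle_count n \<sigma> k = card {c \<in> perm_cycles n \<sigma>. card c = k}"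

definition ewens_prob :: "real \<Rightarrow> nat \<Rightarrow> ((nat \<Rightarrow> nat) \<Rightarrow> bool) \<Rightarrow> real" where
  "ewens_prob \<theta> n P =
     (\<Sum>\<sigma>\<in>{\<sigma>. \<sigma> permutes {1..n} \<and> P \<sigma>}. \<theta> ^ num_cycles n \<sigma>) / pochhammer \<theta> n"

definition falling :: "nat \<Rightarrow> nat \<Rightarrow> real" where
  "falling x r = (\<Prod>i<r. real x - real i)"

definition invol :: "nat \<Rightarrow> (nat \<Rightarrow> nat) \<Rightarrow> real" where
  "invol n a = (\<Prod>k=1..n. real k ^ a k *
      (\<Sum>j=0..a k div 2. falling (a k) (2*j) / (real (2*k) ^ j * fact j)))"

definition Phi :: "real \<Rightarrow> real" where
  "Phi x = measure (density lborel std_normal_density) {..x}"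

end

theory Submission
  imports Defs "HOL-Combinatorics.Orbits" "HOL-Real_Asymp.Real_Asymp"
begin

text \<open>
  Exploring a permutation cycle by cycle (the Feller coupling) turns the Ewens measure into independent
  Bernoulli variables with success probabilities \<open>\<theta> / (\<theta> + j - 1)\<close>, \<open>1 \<le> j \<le> n\<close>, the cycle lengths being
  the spacings of the successes. The length of the spacing that ends at \<open>j\<close> is comparable with \<open>j\<close>, so
  \<open>ln (invol n c)\<close> differs from the independent sum of \<open>ln j\<close> over the successes \<open>j\<close> by an error which
  is at most a multiple of \<open>ln n\<close> except on an event of probability \<open>O (1 / ln n)\<close>: the loss from replacing
  spacings by positions has an exponential moment of polynomial size, and the involution factors are
  controlled by coincidences of spacings. Relative to the standard deviation, of order
  \<open>ln n powr (3 / 2)\<close>, such an error is \<open>O (1 / sqrt (ln n))\<close>. The independent summands are bounded by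
  \<open>ln n\<close>, so Stein's method with the zero-bias coupling yields the normal approximation at the same rate.
\<close>

section \<open>Cycle lengths as spacings\<close>

text \<open>The two parts of the error need different tail bounds. The loss adds up about
  \<open>\<theta> * ln n\<close> terms of order one, so it has the size of the tolerated error
  itself: Markov's inequality on its mean would leave a constant probability, and only an
  exponential moment makes a large multiple of \<open>ln n\<close> improbable. The exponent
  \<open>1 / 4\<close> of that moment is small enough for the singularity at short spacings to stay
  summable. The coincidence term has bounded mean, because coincidences at length \<open>k\<close>
  carry weight \<open>1 / k\<close> and have second moment \<open>O (k powr (- 1 / 2))\<close>;
  Markov's inequality at level \<open>ln n\<close> is then enough. On the normal side no
  concentration inequality enters: one summand moves the normalised sum by at most
  \<open>\<delta>\<close>, so the indicator in the Stein equation is only shifted by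
  \<open>\<delta>\<close>, which the Lipschitz bound on \<open>Phi\<close> absorbs. The
  normalisation uses leading terms only, so the variance of the sum is merely close to
  \<open>1\<close>, and the normal approximation has to carry the defect
  \<open>\<bar>V - 1\<bar>\<close>.\<close>

lemma perm_orbit_refl: "x \<in> perm_orbit \<sigma> x"
  unfolding perm_orbit_def by (auto intro: exI[of _ 0])

lemma perm_orbit_step: "y \<in> perm_orbit \<sigma> x \<Longrightarrow> \<sigma> y \<in> perm_orbit \<sigma> x"
proof -
  assume "y \<in> perm_orbit \<sigma> x"
  then obtain j where "y = (\<sigma> ^^ j) x" unfolding perm_orbit_def by auto
  then have "\<sigma> y = (\<sigma> ^^ Suc j) x" by simp
  then show ?thesis unfolding perm_orbit_def by blast
qed

lemma perm_orbit_least: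
  assumes "x \<in> C" "\<And>y. y \<in> C \<Longrightarrow> \<sigma> y \<in> C"
  shows "perm_orbit \<sigma> x \<subseteq> C"
proof -
  have "(\<sigma> ^^ j) x \<in> C" for j by (induction j) (use assms in auto)
  then show ?thesis unfolding perm_orbit_def by auto
qed

lemma perm_orbit_subset:
  assumes "p permutes S" "x \<in> S" shows "perm_orbit p x \<subseteq> S"
  using assms by (intro perm_orbit_least) (auto simp: permutes_in_image)

text \<open>\<open>perm_orbit\<close> uses forward iterates only, so symmetry rests on iterates of a
  permutation of a finite set returning; it is taken from the library's \<open>orbit\<close>, which
  is the same set for permutations.\<close>

lemma perm_orbit_eq:
  assumes "p permutes S" "finite S" "y \<in> perm_orbit p x"
  shows "perm_orbit p y = perm_orbit p x"
proof
  show "perm_orbit p y \<subseteq> perm_orbit p x"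
    using assms by (intro perm_orbit_least) (auto intro: perm_orbit_step)
  have p: "permutation p" using assms permutation_permutes by blast
  then have eq: "perm_orbit p u = orbit p u" for u
    unfolding perm_orbit_def by (simp add: orbit_altdef_permutation)
  have "x \<in> perm_orbit p y"
    using assms(3) unfolding eq by (rule orbit_swap[OF permutation_self_in_orbit[OF p]])
  then show "perm_orbit p x \<subseteq> perm_orbit p y"
    by (intro perm_orbit_least) (auto intro: perm_orbit_step)
qed

definition cycle_type :: "nat set \<Rightarrow> (nat \<Rightarrow> nat) \<Rightarrow> nat multiset" where
  "cycle_type S \<sigma> = image_mset card (mset_set (perm_orbit \<sigma> ` S))"

text \<open>The exploration keeps the cycle through \<open>x\<close> open. That orbit is removed
  before lengths are taken, so other cycles of equal length keep their entries.\<close>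

definition other_cycles :: "nat set \<Rightarrow> (nat \<Rightarrow> nat) \<Rightarrow> nat \<Rightarrow> nat multiset" where
  "other_cycles S \<sigma> x = image_mset card (mset_set (perm_orbit \<sigma> ` S - {perm_orbit \<sigma> x}))"

lemma cycle_type_split:
  assumes "finite S" "x \<in> S"
  shows "cycle_type S \<sigma> = add_mset (card (perm_orbit \<sigma> x)) (other_cycles S \<sigma> x)"
proof -
  have "perm_orbit \<sigma> ` S = insert (perm_orbit \<sigma> x) (perm_orbit \<sigma> ` S - {perm_orbit \<sigma> x})"
    using assms by auto
  then have "mset_set (perm_orbit \<sigma> ` S)
    = add_mset (perm_orbit \<sigma> x) (mset_set (perm_orbit \<sigma> ` S - {perm_orbit \<sigma> x}))"
    using assms by (metis DiffE finite_Diff finite_imageI insertI1 mset_set.insert)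
  then show ?thesis unfolding cycle_type_def other_cycles_def by simp
qed

section \<open>Inserting one point into a permutation\<close>

context
  fixes S :: "nat set" and x b :: nat and p \<sigma> :: "nat \<Rightarrow> nat"
  assumes fin: "finite S" and xS: "x \<notin> S" and pS: "p permutes S"
  defines "\<sigma> \<equiv> Transposition.transpose x b \<circ> p"
begin

private lemma px: "p x = x" using pS xS by (simp add: permutes_not_in)

lemma perm_orbit_insert_same:
  assumes "y \<in> S" "b \<notin> perm_orbit p y"
  shows "perm_orbit \<sigma> y = perm_orbit p y"
proof -
  have "(\<sigma> ^^ j) y = (p ^^ j) y" for j
  proof (induction j)
    case (Suc j)
    have "(p ^^ Suc j) y \<in> perm_orbit p y" unfolding perm_orbit_def by blast
    moreover have "perm_orbit p y \<subseteq> S" using pS assms by (simp add: perm_orbit_subset)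
    ultimately have "(p ^^ Suc j) y \<noteq> b" "(p ^^ Suc j) y \<noteq> x" using assms xS by auto
    then show ?case using Suc by (simp add: \<sigma>_def transpose_apply_other)
  qed simp
  then show ?thesis unfolding perm_orbit_def by simp
qed

lemma perm_orbit_insert_fix:
  assumes "b = x" shows "\<sigma> = p" "perm_orbit \<sigma> x = {x}"
proof -
  show "\<sigma> = p" unfolding \<sigma>_def assms by simp
  then have "perm_orbit \<sigma> x \<subseteq> {x}" using px by (intro perm_orbit_least) auto
  then show "perm_orbit \<sigma> x = {x}" using perm_orbit_refl by blast
qed

text \<open>The transposition splices \<open>x\<close> in just before \<open>b\<close>:
  \<open>\<sigma>\<close> sends \<open>inv p b\<close> to \<open>x\<close> and \<open>x\<close> to
  \<open>b\<close>, and agrees with \<open>p\<close> elsewhere on \<open>S\<close>.\<close>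

lemma perm_orbit_insert_cycle:
  assumes bS: "b \<in> S" and y: "y \<in> insert x (perm_orbit p b)"
  shows "perm_orbit \<sigma> y = insert x (perm_orbit p b)"
proof -
  have sperm: "\<sigma> permutes insert x S"
    unfolding \<sigma>_def using bS pS
    by (intro permutes_compose) (auto intro: permutes_subset permutes_swap_id)
  have sub: "perm_orbit p b \<subseteq> S" using pS bS by (simp add: perm_orbit_subset)
  have s1: "\<sigma> x = b" by (simp add: \<sigma>_def px)
  have s2: "\<sigma> u = x" if "p u = b" for u using that by (simp add: \<sigma>_def)
  have s3: "\<sigma> u = p u" if "u \<in> S" "p u \<noteq> b" for u
  proof -
    have "p u \<in> S" using that pS by (simp add: permutes_in_image)
    then have "p u \<noteq> x" using xS by auto
    then show ?thesis using that by (simp add: \<sigma>_def transpose_apply_other)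
  qed
  have pj: "(p ^^ j) b \<in> perm_orbit \<sigma> b" for j
  proof (induction j)
    case 0 show ?case by (simp add: perm_orbit_refl)
  next
    case (Suc j)
    have inS: "(p ^^ j) b \<in> S" using sub unfolding perm_orbit_def by blast
    show ?case
    proof (cases "p ((p ^^ j) b) = b")
      case True then show ?thesis by (simp add: perm_orbit_refl)
    next
      case False
      then show ?thesis using s3[OF inS] perm_orbit_step[OF Suc] by simp
    qed
  qed
  have inv: "inv p b \<in> perm_orbit p b"
  proof -
    have "p (inv p b) = b" using pS by (simp add: permutes_inverses)
    then have "b \<in> perm_orbit p (inv p b)" by (metis perm_orbit_refl perm_orbit_step)
    then have "perm_orbit p b = perm_orbit p (inv p b)"
      using perm_orbit_eq[OF pS fin] by blast
    then show ?thesis using perm_orbit_refl by blast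
  qed
  have "x \<in> perm_orbit \<sigma> b"
  proof -
    have "inv p b \<in> perm_orbit \<sigma> b" using inv pj unfolding perm_orbit_def[of p] by auto
    from perm_orbit_step[OF this] show ?thesis
      using s2[of "inv p b"] pS by (simp add: permutes_inverses)
  qed
  then have "insert x (perm_orbit p b) \<subseteq> perm_orbit \<sigma> b"
    using pj unfolding perm_orbit_def[of p] by auto
  moreover have "perm_orbit \<sigma> b \<subseteq> insert x (perm_orbit p b)"
  proof (rule perm_orbit_least)
    show "b \<in> insert x (perm_orbit p b)" using perm_orbit_refl by blast
    fix u assume "u \<in> insert x (perm_orbit p b)"
    then show "\<sigma> u \<in> insert x (perm_orbit p b)"
      using s1 s2 s3 sub perm_orbit_refl[of b p] perm_orbit_step[of _ p b]
      by (metis insert_iff subsetD)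
  qed
  ultimately have eq: "perm_orbit \<sigma> b = insert x (perm_orbit p b)" by blast
  have "y \<in> perm_orbit \<sigma> b" using y eq by simp
  then have "perm_orbit \<sigma> y = perm_orbit \<sigma> b" using perm_orbit_eq[OF sperm] fin by blast
  then show ?thesis using eq by simp
qed

lemma cycle_type_insert_fix:
  assumes "b = x"
  shows "card (perm_orbit \<sigma> x) = 1" "other_cycles (insert x S) \<sigma> x = cycle_type S p"
proof -
  note f = perm_orbit_insert_fix[OF assms]
  show "card (perm_orbit \<sigma> x) = 1" using f by simp
  have "{x} \<notin> perm_orbit p ` S" using perm_orbit_refl xS
    by (metis imageE singletonD)
  then have "perm_orbit \<sigma> ` insert x S - {perm_orbit \<sigma> x} = perm_orbit p ` S" using f by auto
  then show "other_cycles (insert x S) \<sigma> x = cycle_type S p"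
    by (simp add: other_cycles_def cycle_type_def)
qed

text \<open>One step of the exploration: the mark moves from \<open>x\<close> in
  \<open>\<sigma>\<close> to \<open>b\<close> in \<open>p\<close>, and splicing has lengthened only
  the marked cycle.\<close>

lemma cycle_type_insert_cycle:
  assumes bS: "b \<in> S"
  shows "card (perm_orbit \<sigma> x) = Suc (card (perm_orbit p b))"
    "other_cycles (insert x S) \<sigma> x = other_cycles S p b"
proof -
  have sub: "perm_orbit p b \<subseteq> S" using pS bS by (simp add: perm_orbit_subset)
  have ox: "perm_orbit \<sigma> x = insert x (perm_orbit p b)"
    using perm_orbit_insert_cycle[OF bS] by simp
  show "card (perm_orbit \<sigma> x) = Suc (card (perm_orbit p b))"
    unfolding ox using sub xS fin by (metis card_insert_disjoint finite_subset subsetD)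
  have a: "perm_orbit \<sigma> u = perm_orbit \<sigma> x" if "u \<in> perm_orbit p b" for u
    using perm_orbit_insert_cycle[OF bS] that ox by simp
  have c: "perm_orbit \<sigma> u = perm_orbit p u" "perm_orbit p u \<noteq> perm_orbit p b"
      "perm_orbit \<sigma> u \<noteq> perm_orbit \<sigma> x"
    if "u \<in> S" "u \<notin> perm_orbit p b" for u
  proof -
    have nb: "b \<notin> perm_orbit p u" using that perm_orbit_eq[OF pS fin] perm_orbit_refl by blast
    show e: "perm_orbit \<sigma> u = perm_orbit p u" using perm_orbit_insert_same that nb by simp
    show "perm_orbit p u \<noteq> perm_orbit p b" using nb perm_orbit_refl by blast
    show "perm_orbit \<sigma> u \<noteq> perm_orbit \<sigma> x"
      unfolding e ox using pS that perm_orbit_subset xS by blast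
  qed
  have d: "perm_orbit p u = perm_orbit p b" if "u \<in> perm_orbit p b" for u
    using perm_orbit_eq[OF pS fin that] .
  have "perm_orbit \<sigma> ` insert x S - {perm_orbit \<sigma> x} = perm_orbit \<sigma> ` (S - perm_orbit p b)"
    using a c(3) by auto
  also have "\<dots> = perm_orbit p ` (S - perm_orbit p b)"
    using c(1) by (intro image_cong) auto
  also have "\<dots> = perm_orbit p ` S - {perm_orbit p b}"
    using c(2) d by auto
  finally show "other_cycles (insert x S) \<sigma> x = other_cycles S p b"
    by (simp add: other_cycles_def)
qed

end

text \<open>The exploration runs from position \<open>m\<close> down to \<open>1\<close>; the last success above \<open>m\<close> is at
  \<open>m + l + 1\<close>, so the spacing above a success at \<open>Suc m\<close> is \<open>Suc l\<close>.\<close>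
fun spacings :: "nat \<Rightarrow> nat \<Rightarrow> nat set \<Rightarrow> nat multiset" where
  "spacings 0 l A = {#}"
| "spacings (Suc m) l A =
     (if Suc m \<in> A then add_mset (Suc l) (spacings m 0 A) else spacings m (Suc l) A)"

lemma spacings_cong:
  "A \<inter> {1..m} = B \<inter> {1..m} \<Longrightarrow> spacings m l A = spacings m l B"
proof (induction m arbitrary: l)
  case (Suc m)
  have "Suc m \<in> A \<longleftrightarrow> Suc m \<in> B"
    using Suc.prems by (metis IntD1 IntI atLeastAtMost_iff le_add1 order_refl plus_1_eq_Suc)
  moreover have "A \<inter> {1..m} = B \<inter> {1..m}"
  proof -
    have "{1..m} = {1..Suc m} \<inter> {1..m}" by auto
    then show ?thesis using Suc.prems by (metis Int_assoc)
  qed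
  ultimately show ?case using Suc.IH by simp
qed simp

text \<open>Unnormalised law of the exploration: with \<open>j\<close> points left, closing the
  cycle has weight \<open>\<theta>\<close>, and continuing it leaves \<open>j - 1\<close> choices.
  At \<open>j = 1\<close> the second weight is zero, so only sets containing \<open>1\<close>
  contribute.\<close>

definition feller_sum :: "real \<Rightarrow> nat \<Rightarrow> (nat set \<Rightarrow> real) \<Rightarrow> real" where
  "feller_sum \<theta> m g = (\<Sum>A\<in>Pow {1..m}. \<theta> ^ card A * (\<Prod>j\<in>{1..m}-A. real j - 1) * g A)"

lemma sum_Pow_insert:
  fixes h :: "'a set \<Rightarrow> 'b :: comm_monoid_add"
  assumes "x \<notin> S"
  shows "(\<Sum>A\<in>Pow (insert x S). h A) = (\<Sum>A\<in>Pow S. h A) + (\<Sum>A\<in>Pow S. h (insert x A))"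
proof (cases "finite S")
  case True
  have "inj_on (insert x) (Pow S)" using assms by (auto simp: inj_on_def)
  moreover have "Pow S \<inter> insert x ` Pow S = {}" using assms by auto
  ultimately show ?thesis
    using True by (simp add: Pow_insert sum.union_disjoint sum.reindex)
next
  case False
  then have "infinite (Pow S)" "infinite (Pow (insert x S))" by (auto simp: finite_Pow_iff)
  then show ?thesis by simp
qed

lemma feller_sum_Suc:
  assumes "\<And>A. A \<subseteq> {1..m} \<Longrightarrow> g (insert (Suc m) A) = g1 A" "\<And>A. A \<subseteq> {1..m} \<Longrightarrow> g A = g0 A"
  shows "feller_sum \<theta> (Suc m) g = \<theta> * feller_sum \<theta> m g1 + real m * feller_sum \<theta> m g0"
proof -
  have ins: "{1..Suc m} = insert (Suc m) {1..m}" by auto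
  have c: "card (insert (Suc m) A) = Suc (card A)" if "A \<subseteq> {1..m}" for A
    using that finite_subset[OF that] by (subst card_insert_disjoint) auto
  have d1: "insert (Suc m) {1..m} - insert (Suc m) A = {1..m} - A" if "A \<subseteq> {1..m}" for A
    using that by auto
  have d0: "insert (Suc m) {1..m} - A = insert (Suc m) ({1..m} - A)" if "A \<subseteq> {1..m}" for A
    using that by auto
  have e0: "(\<Prod>j\<in>insert (Suc m) {1..m}-A. real j - 1) = real m * (\<Prod>j\<in>{1..m}-A. real j - 1)"
    if "A \<subseteq> {1..m}" for A
    unfolding d0[OF that] by (subst prod.insert) auto
  have s0: "(\<Sum>A\<in>Pow {1..m}. \<theta> ^ card A * (\<Prod>j\<in>insert (Suc m) {1..m}-A. real j - 1) * g A)
     = real m * feller_sum \<theta> m g0"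
    unfolding feller_sum_def sum_distrib_left
    by (intro sum.cong refl) (use e0 assms(2) in auto)
  have s1: "(\<Sum>A\<in>Pow {1..m}. \<theta> ^ card (insert (Suc m) A) *
      (\<Prod>j\<in>insert (Suc m) {1..m} - insert (Suc m) A. real j - 1) * g (insert (Suc m) A))
     = \<theta> * feller_sum \<theta> m g1"
    unfolding feller_sum_def sum_distrib_left
    by (intro sum.cong refl) (simp add: d1 c assms(1))
  show ?thesis
    unfolding feller_sum_def[of \<theta> "Suc m"] ins
    by (subst sum_Pow_insert) (use s0 s1 in auto)
qed

text \<open>The two identities need each other: removing the marked point either closes its cycle,
  which leads to the unmarked identity, or passes the mark to one of the remaining points with
  \<open>l\<close> raised by one. \<open>F\<close> stays arbitrary in the induction because closing
  a cycle composes it with \<open>add_mset (Suc l)\<close>.\<close>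

lemma cycle_type_permutations_sum:
  assumes "finite S" "card S = m"
  shows "(\<Sum>\<sigma> | \<sigma> permutes S. \<theta> ^ size (cycle_type S \<sigma>) * F (cycle_type S \<sigma>))
     = feller_sum \<theta> m (\<lambda>A. F (spacings m 0 A))"
    and "x \<in> S \<Longrightarrow> (\<Sum>\<sigma> | \<sigma> permutes S. \<theta> ^ size (cycle_type S \<sigma>)
           * F (add_mset (card (perm_orbit \<sigma> x) + l) (other_cycles S \<sigma> x)))
     = feller_sum \<theta> m (\<lambda>A. F (spacings m l A))"
proof -
  have both: "(\<Sum>\<sigma> | \<sigma> permutes S. \<theta> ^ size (cycle_type S \<sigma>) * F (cycle_type S \<sigma>))
     = feller_sum \<theta> m (\<lambda>A. F (spacings m 0 A)) \<and>
    (\<forall>x\<in>S. \<forall>l. (\<Sum>\<sigma> | \<sigma> permutes S. \<theta> ^ size (cycle_type S \<sigma>)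
           * F (add_mset (card (perm_orbit \<sigma> x) + l) (other_cycles S \<sigma> x)))
     = feller_sum \<theta> m (\<lambda>A. F (spacings m l A)))"
    using assms
  proof (induction m arbitrary: S F)
    case 0
    then have "S = {}" by simp
    then show ?case by (simp add: cycle_type_def feller_sum_def)
  next
    case (Suc m)
    have marked: "(\<Sum>\<sigma> | \<sigma> permutes S. \<theta> ^ size (cycle_type S \<sigma>)
           * F (add_mset (card (perm_orbit \<sigma> x) + l) (other_cycles S \<sigma> x)))
     = feller_sum \<theta> (Suc m) (\<lambda>A. F (spacings (Suc m) l A))" if xS: "x \<in> S" for x l
    proof -
      define T where "T = S - {x}"
      have T: "finite T" "card T = m" "x \<notin> T" "S = insert x T"
        using Suc.prems xS by (auto simp: T_def)
      define h where "h = (\<lambda>\<sigma>. \<theta> ^ size (cycle_type S \<sigma>)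
           * F (add_mset (card (perm_orbit \<sigma> x) + l) (other_cycles S \<sigma> x)))"
      have h: "h \<sigma> = \<theta> ^ Suc (size (other_cycles S \<sigma> x))
           * F (add_mset (card (perm_orbit \<sigma> x) + l) (other_cycles S \<sigma> x))" for \<sigma>
        using cycle_type_split[OF Suc.prems(1) xS] by (simp add: h_def)
      have hx: "h (Transposition.transpose x x \<circ> p)
          = \<theta> * (\<theta> ^ size (cycle_type T p) * F (add_mset (Suc l) (cycle_type T p)))"
        if "p permutes T" for p
        unfolding h using cycle_type_insert_fix[OF T(1,3) that refl] by (simp add: T(4))
      have hb: "h (Transposition.transpose x b \<circ> p)
          = \<theta> ^ size (cycle_type T p)
             * F (add_mset (card (perm_orbit p b) + Suc l) (other_cycles T p b))"
        if "p permutes T" "b \<in> T" for p b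
        unfolding h using cycle_type_insert_cycle[OF T(1,3) that]
          cycle_type_split[OF T(1) that(2), of p] by (simp add: T(4))
      have "(\<Sum>\<sigma> | \<sigma> permutes S. h \<sigma>) =
          (\<Sum>b\<in>S. \<Sum>p | p permutes T. h (Transposition.transpose x b \<circ> p))"
        unfolding T(4) by (rule sum_over_permutations_insert[OF T(1,3)])
      also have "\<dots> = (\<Sum>p | p permutes T. h (Transposition.transpose x x \<circ> p)) +
           (\<Sum>b\<in>T. \<Sum>p | p permutes T. h (Transposition.transpose x b \<circ> p))"
        unfolding T(4) using T(1,3) by simp
      also have "(\<Sum>p | p permutes T. h (Transposition.transpose x x \<circ> p))
          = \<theta> * feller_sum \<theta> m (\<lambda>A. F (add_mset (Suc l) (spacings m 0 A)))"
        using conjunct1[OF Suc.IH[OF T(1,2), of "\<lambda>M. F (add_mset (Suc l) M)"]]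
        by (simp add: hx sum_distrib_left[symmetric] del: transpose_same)
      \<comment> \<open>By induction the inner sum does not depend on the mark
        \<open>b\<close>.\<close>
      also have "(\<Sum>b\<in>T. \<Sum>p | p permutes T. h (Transposition.transpose x b \<circ> p))
          = (\<Sum>b\<in>T. feller_sum \<theta> m (\<lambda>A. F (spacings m (Suc l) A)))"
        using conjunct2[OF Suc.IH[OF T(1,2), of F], rule_format, where l="Suc l"]
        by (intro sum.cong refl) (simp add: hb)
      also have "\<dots> = real m * feller_sum \<theta> m (\<lambda>A. F (spacings m (Suc l) A))"
        using T(2) by simp
      also have "\<theta> * feller_sum \<theta> m (\<lambda>A. F (add_mset (Suc l) (spacings m 0 A))) + \<dots>
          = feller_sum \<theta> (Suc m) (\<lambda>A. F (spacings (Suc m) l A))"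
      proof (rule feller_sum_Suc[symmetric])
        fix A assume A: "A \<subseteq> {1..m}"
        have "spacings m 0 (insert (Suc m) A) = spacings m 0 A" by (rule spacings_cong) auto
        then show "F (spacings (Suc m) l (insert (Suc m) A)) = F (add_mset (Suc l) (spacings m 0 A))"
          by simp
        have "Suc m \<notin> A" using A by auto
        then show "F (spacings (Suc m) l A) = F (spacings m (Suc l) A)" by simp
      qed
      finally show ?thesis unfolding h_def .
    qed
    obtain x where x: "x \<in> S" using Suc.prems by fastforce
    have "(\<Sum>\<sigma> | \<sigma> permutes S. \<theta> ^ size (cycle_type S \<sigma>) * F (cycle_type S \<sigma>))
       = feller_sum \<theta> (Suc m) (\<lambda>A. F (spacings (Suc m) 0 A))"
      using marked[OF x, of 0] cycle_type_split[OF Suc.prems(1) x] by simp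
    then show ?case using marked by blast
  qed
  then show "(\<Sum>\<sigma> | \<sigma> permutes S. \<theta> ^ size (cycle_type S \<sigma>) * F (cycle_type S \<sigma>))
     = feller_sum \<theta> m (\<lambda>A. F (spacings m 0 A))" ..
  show "x \<in> S \<Longrightarrow> (\<Sum>\<sigma> | \<sigma> permutes S. \<theta> ^ size (cycle_type S \<sigma>)
           * F (add_mset (card (perm_orbit \<sigma> x) + l) (other_cycles S \<sigma> x)))
     = feller_sum \<theta> m (\<lambda>A. F (spacings m l A))"
    using both by blast
qed

section \<open>Finite families of independent Bernoulli variables\<close>

text \<open>A finite weighted sum in place of a product measure, so that conditioning on one
  coordinate is plain algebra.\<close>

definition bern_exp :: "('a \<Rightarrow> real) \<Rightarrow> 'a set \<Rightarrow> ('a set \<Rightarrow> real) \<Rightarrow> real" where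
  "bern_exp p J g = (\<Sum>A\<in>Pow J. (\<Prod>j\<in>A. p j) * (\<Prod>j\<in>J-A. 1 - p j) * g A)"

lemma bern_exp_cong:
  "(\<And>A. A \<subseteq> J \<Longrightarrow> g A = h A) \<Longrightarrow> bern_exp p J g = bern_exp p J h"
  unfolding bern_exp_def by (intro sum.cong) auto

lemma bern_exp_add: "bern_exp p J (\<lambda>A. g A + h A) = bern_exp p J g + bern_exp p J h"
  unfolding bern_exp_def by (simp add: sum.distrib[symmetric] algebra_simps)

lemma bern_exp_diff: "bern_exp p J (\<lambda>A. g A - h A) = bern_exp p J g - bern_exp p J h"
  unfolding bern_exp_def by (simp add: sum_subtractf[symmetric] algebra_simps)

lemma bern_exp_cmult: "bern_exp p J (\<lambda>A. c * g A) = c * bern_exp p J g"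
  unfolding bern_exp_def by (simp add: sum_distrib_left algebra_simps)

lemma bern_exp_sum: "bern_exp p J (\<lambda>A. \<Sum>i\<in>I. g i A) = (\<Sum>i\<in>I. bern_exp p J (g i))"
  unfolding bern_exp_def sum_distrib_left by (rule sum.swap)

lemma bern_exp_insert:
  assumes "finite J" "i \<notin> J"
  shows "bern_exp p (insert i J) g
     = p i * bern_exp p J (\<lambda>A. g (insert i A)) + (1 - p i) * bern_exp p J g"
proof -
  let ?w = "\<lambda>J A. (\<Prod>j\<in>A. p j) * (\<Prod>j\<in>J-A. 1 - p j)"
  have w1: "?w (insert i J) (insert i A) = p i * ?w J A" if "A \<subseteq> J" for A
  proof -
    have "finite A" "i \<notin> A" "insert i J - insert i A = J - A"
      using that assms finite_subset by auto
    then show ?thesis by simp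
  qed
  have w0: "?w (insert i J) A = (1 - p i) * ?w J A" if "A \<subseteq> J" for A
  proof -
    have "insert i J - A = insert i (J - A)" using that assms by auto
    then show ?thesis using assms by simp
  qed
  have "bern_exp p (insert i J) g = (\<Sum>A\<in>Pow J. ?w (insert i J) A * g A)
       + (\<Sum>A\<in>Pow J. ?w (insert i J) (insert i A) * g (insert i A))"
    unfolding bern_exp_def by (rule sum_Pow_insert[OF assms(2)])
  also have "(\<Sum>A\<in>Pow J. ?w (insert i J) A * g A) = (1 - p i) * bern_exp p J g"
    unfolding bern_exp_def sum_distrib_left by (intro sum.cong refl) (use w0 in auto)
  also have "(\<Sum>A\<in>Pow J. ?w (insert i J) (insert i A) * g (insert i A))
       = p i * bern_exp p J (\<lambda>A. g (insert i A))"
    unfolding bern_exp_def sum_distrib_left by (intro sum.cong refl) (use w1 in auto)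
  finally show ?thesis by simp
qed

lemma bern_exp_const:
  assumes "finite J" shows "bern_exp p J (\<lambda>A. c) = c"
  using assms
proof (induction J)
  case empty show ?case by (simp add: bern_exp_def)
next
  case (insert i J) then show ?case by (simp add: bern_exp_insert algebra_simps)
qed

text \<open>Unlike in \<open>bern_exp_insert\<close>, the index set stays \<open>J\<close>:
  coordinate \<open>i\<close> is overwritten by success or failure, so both terms are expectations
  over the same family.\<close>

lemma bern_exp_condition:
  assumes "finite J" "i \<in> J"
  shows "bern_exp p J g
     = p i * bern_exp p J (\<lambda>A. g (insert i A)) + (1 - p i) * bern_exp p J (\<lambda>A. g (A - {i}))"
proof -
  define K where "K = J - {i}"
  have K: "finite K" "i \<notin> K" "J = insert i K" using assms by (auto simp: K_def)
  have "bern_exp p J (\<lambda>A. g (insert i A)) = bern_exp p K (\<lambda>A. g (insert i A))"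
    unfolding K(3) bern_exp_insert[OF K(1,2)] by (simp add: algebra_simps)
  moreover have "bern_exp p J (\<lambda>A. g (A - {i})) = bern_exp p K g"
  proof -
    have "bern_exp p K (\<lambda>A. g (insert i A - {i})) = bern_exp p K g"
      "bern_exp p K (\<lambda>A. g (A - {i})) = bern_exp p K g"
      using K(2) by (auto intro!: bern_exp_cong arg_cong[of _ _ g])
    then show ?thesis unfolding K(3) bern_exp_insert[OF K(1,2)] by (simp add: algebra_simps)
  qed
  ultimately show ?thesis using bern_exp_insert[OF K(1,2)] K(3) by simp
qed

context
  fixes p :: "'a \<Rightarrow> real" and J :: "'a set"
  assumes fin: "finite J" and p01: "\<And>j. j \<in> J \<Longrightarrow> 0 \<le> p j \<and> p j \<le> 1"
begin

lemma bern_exp_mono: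
  assumes "\<And>A. A \<subseteq> J \<Longrightarrow> g A \<le> h A"
  shows "bern_exp p J g \<le> bern_exp p J h"
  unfolding bern_exp_def using p01 assms
  by (intro sum_mono mult_left_mono mult_nonneg_nonneg prod_nonneg) auto

lemma bern_exp_bounds:
  assumes "\<And>A. A \<subseteq> J \<Longrightarrow> l \<le> g A" "\<And>A. A \<subseteq> J \<Longrightarrow> g A \<le> u"
  shows "l \<le> bern_exp p J g" "bern_exp p J g \<le> u"
  using bern_exp_mono[of "\<lambda>A. l" g] bern_exp_mono[of g "\<lambda>A. u"] assms
  by (auto simp: bern_exp_const[OF fin])

lemma bern_exp_markov:
  assumes "\<And>A. A \<subseteq> J \<Longrightarrow> 0 \<le> g A" "c > 0"
  shows "bern_exp p J (\<lambda>A. of_bool (g A > c)) \<le> bern_exp p J g / c"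
proof -
  have "bern_exp p J (\<lambda>A. of_bool (g A > c)) \<le> bern_exp p J (\<lambda>A. (1/c) * g A)"
    using assms by (intro bern_exp_mono) auto
  then show ?thesis by (simp only: bern_exp_cmult) simp
qed

lemma bern_exp_subset:
  assumes "B \<subseteq> J"
  shows "bern_exp p J (\<lambda>A. of_bool (B \<subseteq> A)) = (\<Prod>j\<in>B. p j)"
proof -
  have "finite B" using assms fin finite_subset by blast
  then show ?thesis using assms
  proof (induction B)
    case empty show ?case by (simp add: bern_exp_const[OF fin])
  next
    case (insert i B)
    have "bern_exp p J (\<lambda>A. of_bool (insert i B \<subseteq> A)) =
       p i * bern_exp p J (\<lambda>A. of_bool (B \<subseteq> insert i A))"
      using bern_exp_condition[OF fin, of i p "\<lambda>A. of_bool (insert i B \<subseteq> A)"] insert.prems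
      by (simp add: bern_exp_const[OF fin])
    also have "(\<lambda>A. of_bool (B \<subseteq> insert i A)) = (\<lambda>A. of_bool (B \<subseteq> A))"
      using insert.hyps by (auto simp: fun_eq_iff)
    finally show ?case using insert by simp
  qed
qed

text \<open>Success and failure at \<open>i\<close> receive the weights
  \<open>p i * (1 - p i)\<close> and its negative: a discrete integration by parts, the source of
  the zero-bias identity.\<close>

lemma bern_exp_centered:
  assumes "i \<in> J"
  shows "bern_exp p J (\<lambda>A. (of_bool (i \<in> A) - p i) * g A)
    = p i * (1 - p i) * bern_exp p J (\<lambda>A. g (insert i A) - g (A - {i}))"
  by (subst bern_exp_condition[OF fin assms])
    (simp add: bern_exp_cmult bern_exp_cmult[of _ _ "- p i", simplified] bern_exp_diff
      right_diff_distrib left_diff_distrib)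

end

subsection \<open>The Stein equation for the normal distribution function\<close>

lemma real_distribution_std_normal: "real_distribution std_normal_distribution"
  by (simp add: real_dist_normal_dist)

lemma Phi_eq_cdf: "Phi = cdf std_normal_distribution"
  by (simp add: fun_eq_iff Phi_def cdf_def)

interpretation std_normal: real_distribution std_normal_distribution
  by (rule real_distribution_std_normal)

lemma Phi_bounds: "0 \<le> Phi x" "Phi x \<le> 1"
  unfolding Phi_eq_cdf using std_normal.cdf_nonneg std_normal.cdf_bounded_prob by auto

lemma Phi_mono: "x \<le> y \<Longrightarrow> Phi x \<le> Phi y"
  unfolding Phi_eq_cdf by (rule std_normal.cdf_nondecreasing)

lemma Phi_at_top: "(Phi \<longlongrightarrow> 1) at_top"
  unfolding Phi_eq_cdf by (rule std_normal.cdf_lim_at_top_prob)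

lemma continuous_on_std_normal_density: "continuous_on S std_normal_density"
  unfolding std_normal_density_def by (intro continuous_intros) auto

lemma Phi_diff:
  assumes "x \<le> y"
  shows "Phi y - Phi x = integral {x..y} std_normal_density"
proof (cases "x = y")
  case False
  have "Phi y - Phi x = measure std_normal_distribution {x<..y}"
    unfolding Phi_eq_cdf using False assms by (intro std_normal.cdf_diff_eq) auto
  also have "\<dots> = integral\<^sup>L std_normal_distribution (indicator {x<..y})"
    by simp
  also have "\<dots> = (LINT t:{x<..y}|lborel. std_normal_density t)"
    unfolding set_lebesgue_integral_def
    by (subst integral_density) (auto simp: mult.commute)
  also have "\<dots> = integral {x<..y} std_normal_density"
    by (intro set_borel_integral_eq_integral) (use integrable_mult_indicator[of "{x<..y}" lborel std_normal_density] in
        \<open>auto simp: set_integrable_def\<close>)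
  also have "\<dots> = integral {x..y} std_normal_density"
    by (rule integral_spike_set) (auto intro: negligible_subset[of "{x}"])
  finally show ?thesis .
qed simp

lemma DERIV_Phi: "(Phi has_real_derivative std_normal_density x) (at x)"
proof -
  let ?a = "x - 1" and ?b = "x + 1"
  have "((\<lambda>t. integral {?a..t} std_normal_density) has_real_derivative std_normal_density x)
       (at x within {?a..?b})"
    by (intro integral_has_real_derivative continuous_on_std_normal_density) auto
  then have "((\<lambda>t. Phi ?a + integral {?a..t} std_normal_density) has_real_derivative std_normal_density x)
       (at x within {?a..?b})"
    by (auto intro!: derivative_eq_intros)
  then have "(Phi has_real_derivative std_normal_density x) (at x within {?a..?b})"
    by (rule has_field_derivative_transform_within[where d=1]) (auto simp: Phi_diff[symmetric])
  then show ?thesis by (simp add: at_within_Icc_at)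
qed

text \<open>The density is even, so \<open>Phi x + Phi (- x)\<close> has derivative zero; its limit
  at infinity is \<open>1\<close>.\<close>

lemma Phi_minus: "Phi (-x) = 1 - Phi x"
proof -
  have d: "((\<lambda>x. Phi x + Phi (-x)) has_real_derivative 0) (at x)" for x
    by (rule derivative_eq_intros DERIV_Phi DERIV_chain2[of Phi] | simp add: std_normal_density_def)+
  have const: "Phi y + Phi (-y) = Phi x + Phi (-x)" for y
    using DERIV_isconst_all[of "\<lambda>x. Phi x + Phi (-x)"] d by blast
  have "((\<lambda>x. Phi x + Phi (-x)) \<longlongrightarrow> 1 + 0) at_top"
  proof (intro tendsto_add Phi_at_top)
    have "(Phi \<longlongrightarrow> 0) at_bot" unfolding Phi_eq_cdf by (rule std_normal.cdf_lim_at_bot)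
    then show "((\<lambda>x. Phi (- x)) \<longlongrightarrow> 0) at_top"
      by (rule filterlim_compose) (rule filterlim_uminus_at_bot_at_top)
  qed
  moreover have "(\<lambda>y. Phi y + Phi (-y)) = (\<lambda>y. Phi x + Phi (-x))" by (rule ext, rule const)
  ultimately have "((\<lambda>y. Phi x + Phi (-x)) \<longlongrightarrow> 1) (at_top :: real filter)"
    by (metis add.right_neutral)
  then have "Phi x + Phi (-x) = 1" by (simp add: tendsto_const_iff)
  then show ?thesis by simp
qed

text \<open>The function \<open>g\<close> has derivative
  \<open>- std_normal_density t / t\<^sup>2\<close>, hence decreases to its limit \<open>1\<close>
  and stays above it.\<close>

lemma mills_ratio:
  assumes "w > 0" shows "w * (1 - Phi w) \<le> std_normal_density w"
proof -
  define g where "g = (\<lambda>w. std_normal_density w / w + Phi w)"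
  have d: "(std_normal_density has_real_derivative - (t * std_normal_density t)) (at t)" for t
    unfolding std_normal_density_def
    by (rule derivative_eq_intros refl | simp)+
  have dg: "(g has_real_derivative - (std_normal_density t / t\<^sup>2)) (at t)" if "t > 0" for t
    unfolding g_def using that
    by (auto intro!: derivative_eq_intros d DERIV_Phi simp: field_simps power2_eq_square)
  have dec: "g y \<le> g w" if "y \<ge> w" for y
  proof (rule DERIV_nonpos_imp_nonincreasing[OF that])
    fix t assume "w \<le> t"
    then show "\<exists>y. (g has_real_derivative y) (at t) \<and> y \<le> 0"
      using dg[of t] assms by (intro exI[of _ "- (std_normal_density t / t\<^sup>2)"]) auto
  qed
  have "((\<lambda>w. std_normal_density w / w) \<longlongrightarrow> 0) at_top"
    unfolding std_normal_density_def by real_asymp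
  from tendsto_add[OF this Phi_at_top] have "(g \<longlongrightarrow> 1) at_top" unfolding g_def by simp
  then have "1 \<le> g w"
    by (rule tendsto_upperbound) (auto intro: eventually_at_top_linorderI[of w] dec)
  then show ?thesis unfolding g_def using assms by (simp add: field_simps)
qed

text \<open>For \<open>w \<ge> 1\<close> the first bound follows from the second. Below
  \<open>1\<close> crude estimates do: \<open>6\<close> is \<open>3 * 2\<close>, from
  \<open>sqrt (2 * pi) \<le> 3\<close> and \<open>exp (1 / 2) \<le> 2\<close>.\<close>

lemma mills_bounds:
  assumes "w \<ge> 0"
  shows "sqrt (2*pi) * exp (w\<^sup>2/2) * (1 - Phi w) \<le> 6"
    and "w * (sqrt (2*pi) * exp (w\<^sup>2/2) * (1 - Phi w)) \<le> 1"
proof -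
  have eq: "sqrt (2*pi) * exp (w\<^sup>2/2) * std_normal_density w = 1"
    by (simp add: std_normal_density_def exp_minus field_simps)
  show b: "w * (sqrt (2*pi) * exp (w\<^sup>2/2) * (1 - Phi w)) \<le> 1"
  proof (cases "w = 0")
    case False
    have "(sqrt (2*pi) * exp (w\<^sup>2/2)) * (w * (1 - Phi w))
        \<le> (sqrt (2*pi) * exp (w\<^sup>2/2)) * std_normal_density w"
      using assms False mills_ratio by (intro mult_left_mono) auto
    then show ?thesis using eq by (simp add: algebra_simps)
  qed simp
  let ?M = "sqrt (2*pi) * exp (w\<^sup>2/2) * (1 - Phi w)"
  have M0: "?M \<ge> 0" using Phi_bounds by simp
  show "?M \<le> 6"
  proof (cases "w \<ge> 1")
    case True
    then have "?M \<le> w * ?M" using M0 by (metis mult_right_mono mult_1)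
    then show ?thesis using b by linarith
  next
    case False
    then have "w\<^sup>2 \<le> 1" using assms by (simp add: power_le_one)
    then have "exp (w\<^sup>2/2) \<le> exp (1/2)" by simp
    also have "\<dots> \<le> 2" using exp_half_le2 by simp
    finally have e: "exp (w\<^sup>2/2) \<le> 2" .
    have "sqrt (2*pi) \<le> sqrt 9" using pi_less_4 by (intro real_sqrt_le_mono) linarith
    then have "sqrt (2*pi) \<le> 3" by simp
    then have "?M \<le> 3 * 2 * 1" using e Phi_bounds
      by (intro mult_mono) auto
    then show ?thesis by simp
  qed
qed

text \<open>The bounded solution of the Stein equation
  \<open>f' w - w * f w = of_bool (w \<le> z) - Phi z\<close>; its derivative jumps at
  \<open>z\<close>.\<close>

definition stein :: "real \<Rightarrow> real \<Rightarrow> real" where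
  "stein z w = sqrt (2*pi) * exp (w\<^sup>2/2) *
     (if w \<le> z then Phi w * (1 - Phi z) else Phi z * (1 - Phi w))"

text \<open>Either branch is at most \<open>min (Phi w) (1 - Phi w)\<close>, which by symmetry is
  the upper tail at \<open>\<bar>w\<bar>\<close>.\<close>

lemma stein_le_mills:
  "0 \<le> stein z w" "stein z w \<le> sqrt (2*pi) * exp (\<bar>w\<bar>\<^sup>2/2) * (1 - Phi \<bar>w\<bar>)"
proof -
  show "0 \<le> stein z w" using Phi_bounds by (simp add: stein_def)
  have "(if w \<le> z then Phi w * (1 - Phi z) else Phi z * (1 - Phi w)) \<le> 1 - Phi \<bar>w\<bar>"
  proof (cases "w \<ge> 0")
    case True
    have "Phi w * (1 - Phi z) \<le> 1 * (1 - Phi w)" if "w \<le> z"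
      using Phi_bounds Phi_mono[OF that] by (intro mult_mono) auto
    moreover have "Phi z * (1 - Phi w) \<le> 1 * (1 - Phi w)"
      using Phi_bounds by (intro mult_right_mono) auto
    ultimately show ?thesis using True by auto
  next
    case False
    then have eq: "1 - Phi \<bar>w\<bar> = Phi w" using Phi_minus[of w] by simp
    have "Phi z * (1 - Phi w) \<le> Phi w * 1" if "z \<le> w"
      using Phi_bounds Phi_mono[OF that] by (intro mult_mono) auto
    moreover have "Phi w * (1 - Phi z) \<le> Phi w * 1"
      using Phi_bounds by (intro mult_left_mono) auto
    ultimately show ?thesis unfolding eq by auto
  qed
  then show "stein z w \<le> sqrt (2*pi) * exp (\<bar>w\<bar>\<^sup>2/2) * (1 - Phi \<bar>w\<bar>)"
    unfolding stein_def by (simp only: power2_abs) (intro mult_left_mono, auto)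
qed

lemma stein_bound: "\<bar>stein z w\<bar> \<le> 6" "\<bar>w * stein z w\<bar> \<le> 1"
proof -
  show "\<bar>stein z w\<bar> \<le> 6" using stein_le_mills[of z w] mills_bounds(1)[of "\<bar>w\<bar>"] by simp
  have "\<bar>w * stein z w\<bar> = \<bar>w\<bar> * stein z w" using stein_le_mills by (simp add: abs_mult)
  also have "\<dots> \<le> \<bar>w\<bar> * (sqrt (2*pi) * exp (\<bar>w\<bar>\<^sup>2/2) * (1 - Phi \<bar>w\<bar>))"
    using stein_le_mills by (intro mult_left_mono) auto
  also have "\<dots> \<le> 1" by (rule mills_bounds) simp
  finally show "\<bar>w * stein z w\<bar> \<le> 1" .
qed

context
  fixes z :: real
begin

private definition left :: "real \<Rightarrow> real" where
  "left w = sqrt (2*pi) * exp (w\<^sup>2/2) * (Phi w * (1 - Phi z))"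
private definition right :: "real \<Rightarrow> real" where
  "right w = sqrt (2*pi) * exp (w\<^sup>2/2) * (Phi z * (1 - Phi w))"

private lemma density_cancel: "sqrt (2*pi) * exp (t\<^sup>2/2) * std_normal_density t = 1"
  by (simp add: std_normal_density_def exp_minus field_simps)

private lemma left_deriv: "(left has_real_derivative (t * left t + 1 - Phi z)) (at t)"
proof -
  have "(left has_real_derivative
     (t * left t + (sqrt (2*pi) * exp (t\<^sup>2/2) * std_normal_density t) * (1 - Phi z))) (at t)"
    unfolding left_def by (auto intro!: derivative_eq_intros DERIV_Phi simp: algebra_simps)
  then show ?thesis unfolding density_cancel by (simp add: algebra_simps)
qed

private lemma right_deriv: "(right has_real_derivative (t * right t - Phi z)) (at t)"
proof -
  have "(right has_real_derivative
     (t * right t - (sqrt (2*pi) * exp (t\<^sup>2/2) * std_normal_density t) * Phi z)) (at t)"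
    unfolding right_def by (auto intro!: derivative_eq_intros DERIV_Phi simp: algebra_simps)
  then show ?thesis unfolding density_cancel by simp
qed

private lemma stein_left: "w \<le> z \<Longrightarrow> stein z w = left w"
  and stein_right: "z \<le> w \<Longrightarrow> stein z w = right w"
  by (auto simp: stein_def left_def right_def)

lemma stein_mvt_left:
  assumes "a \<le> b" "b \<le> z"
  obtains t where "a \<le> t" "t \<le> b" "stein z b - stein z a = (t * stein z t + 1 - Phi z) * (b - a)"
proof (cases "a = b")
  case False
  then have "\<exists>t>a. t < b \<and> left b - left a = (b - a) * (t * left t + 1 - Phi z)"
    using left_deriv assms(1) by (intro MVT2) auto
  then obtain t where "a < t" "t < b" "left b - left a = (b - a) * (t * left t + 1 - Phi z)"
    by blast
  then show ?thesis using that[of t] assms by (simp add: stein_left)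
qed (use that in auto)

lemma stein_mvt_right:
  assumes "a \<le> b" "z \<le> a"
  obtains t where "a \<le> t" "t \<le> b" "stein z b - stein z a = (t * stein z t - Phi z) * (b - a)"
proof (cases "a = b")
  case False
  then have "\<exists>t>a. t < b \<and> right b - right a = (b - a) * (t * right t - Phi z)"
    using right_deriv assms(1) by (intro MVT2) auto
  then obtain t where "a < t" "t < b" "right b - right a = (b - a) * (t * right t - Phi z)"
    by blast
  then show ?thesis using that[of t] assms by (simp add: stein_right)
qed (use that in auto)

text \<open>The mean value theorem on each side of the jump. Left of \<open>z\<close> the slope
  bound is larger by \<open>1\<close>, and it covers the whole interval as soon as
  \<open>a \<le> z\<close>; hence the indicator sits at the left endpoint here and at the right
  endpoint in the lower bound.\<close>

lemma stein_increment_le: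
  assumes "a \<le> b" "\<And>t. a \<le> t \<Longrightarrow> t \<le> b \<Longrightarrow> t * stein z t \<le> m"
  shows "stein z b - stein z a \<le> (m + of_bool (a \<le> z) - Phi z) * (b - a)"
proof -
  have L: "stein z d - stein z c \<le> (m + 1 - Phi z) * (d - c)" if "a \<le> c" "c \<le> d" "d \<le> b" "d \<le> z" for c d
  proof -
    obtain t where t: "c \<le> t" "t \<le> d" "stein z d - stein z c = (t * stein z t + 1 - Phi z) * (d - c)"
      using stein_mvt_left \<open>c \<le> d\<close> \<open>d \<le> z\<close> by blast
    have "t * stein z t \<le> m" using assms(2) t that by simp
    then show ?thesis unfolding t(3) using that by (intro mult_right_mono) auto
  qed
  have R: "stein z d - stein z c \<le> (m - Phi z) * (d - c)" if "a \<le> c" "c \<le> d" "d \<le> b" "z \<le> c" for c d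
  proof -
    obtain t where t: "c \<le> t" "t \<le> d" "stein z d - stein z c = (t * stein z t - Phi z) * (d - c)"
      using stein_mvt_right \<open>c \<le> d\<close> \<open>z \<le> c\<close> by blast
    have "t * stein z t \<le> m" using assms(2) t that by simp
    then show ?thesis unfolding t(3) using that by (intro mult_right_mono) auto
  qed
  consider "b \<le> z" | "z < a" | "a \<le> z" "z < b" by linarith
  then show ?thesis
  proof cases
    case 1 then show ?thesis using L[of a b] assms(1) by simp
  next
    case 2 then show ?thesis using R[of a b] assms(1) by simp
  next
    case 3
    have "stein z z - stein z a \<le> (m + 1 - Phi z) * (z - a)" using L 3 by simp
    moreover have "stein z b - stein z z \<le> (m - Phi z) * (b - z)" using R 3 by simp
    ultimately show ?thesis using 3 by (simp add: algebra_simps)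
  qed
qed

lemma stein_increment_ge:
  assumes "a \<le> b" "\<And>t. a \<le> t \<Longrightarrow> t \<le> b \<Longrightarrow> m \<le> t * stein z t"
  shows "(m + of_bool (b \<le> z) - Phi z) * (b - a) \<le> stein z b - stein z a"
proof -
  have L: "(m + 1 - Phi z) * (d - c) \<le> stein z d - stein z c" if "a \<le> c" "c \<le> d" "d \<le> b" "d \<le> z" for c d
  proof -
    obtain t where t: "c \<le> t" "t \<le> d" "stein z d - stein z c = (t * stein z t + 1 - Phi z) * (d - c)"
      using stein_mvt_left \<open>c \<le> d\<close> \<open>d \<le> z\<close> by blast
    have "m \<le> t * stein z t" using assms(2) t that by simp
    then show ?thesis unfolding t(3) using that by (intro mult_right_mono) auto
  qed
  have R: "(m - Phi z) * (d - c) \<le> stein z d - stein z c" if "a \<le> c" "c \<le> d" "d \<le> b" "z \<le> c" for c d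
  proof -
    obtain t where t: "c \<le> t" "t \<le> d" "stein z d - stein z c = (t * stein z t - Phi z) * (d - c)"
      using stein_mvt_right \<open>c \<le> d\<close> \<open>z \<le> c\<close> by blast
    have "m \<le> t * stein z t" using assms(2) t that by simp
    then show ?thesis unfolding t(3) using that by (intro mult_right_mono) auto
  qed
  consider "b \<le> z" | "z \<le> a" "z < b" | "a < z" "z < b" by linarith
  then show ?thesis
  proof cases
    case 1 then show ?thesis using L[of a b] assms(1) by simp
  next
    case 2 then show ?thesis using R[of a b] assms(1) by simp
  next
    case 3
    have "(m + 1 - Phi z) * (z - a) \<le> stein z z - stein z a" using L 3 by simp
    moreover have "(m - Phi z) * (b - z) \<le> stein z b - stein z z" using R 3 by simp
    ultimately show ?thesis using 3 by (simp add: algebra_simps)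
  qed
qed

text \<open>The slope is \<open>t * stein z t\<close>, at most \<open>1\<close> in absolute value,
  plus a number in \<open>[-1, 1]\<close>.\<close>

lemma stein_lipschitz: "\<bar>stein z b - stein z a\<bar> \<le> 2 * \<bar>b - a\<bar>"
proof -
  have *: "\<bar>stein z b - stein z a\<bar> \<le> 2 * (b - a)" if "a \<le> b" for a b
  proof -
    have m: "-1 \<le> t * stein z t \<and> t * stein z t \<le> 1" for t
      using stein_bound(2)[of t z] by linarith
    have "stein z b - stein z a \<le> (1 + of_bool (a \<le> z) - Phi z) * (b - a)"
      using m that by (intro stein_increment_le) auto
    also have "\<dots> \<le> 2 * (b - a)" using that Phi_bounds[of z] by (intro mult_right_mono) auto
    finally have 1: "stein z b - stein z a \<le> 2 * (b - a)" .
    have "(-2) * (b - a) \<le> (-1 + of_bool (b \<le> z) - Phi z) * (b - a)"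
      using that Phi_bounds[of z] by (intro mult_right_mono) auto
    also have "\<dots> \<le> stein z b - stein z a"
      using m that by (intro stein_increment_ge) auto
    finally show ?thesis using 1 by linarith
  qed
  show ?thesis
  proof (cases "a \<le> b")
    case True then show ?thesis using *[of a b] by simp
  next
    case False then show ?thesis using *[of b a] by (simp add: abs_minus_commute)
  qed
qed

lemma stein_product_increment:
  "\<bar>t * stein z t - c * stein z c\<bar> \<le> (6 + 2 * \<bar>c\<bar>) * \<bar>t - c\<bar>"
proof -
  have "t * stein z t - c * stein z c = (t - c) * stein z t + c * (stein z t - stein z c)"
    by (simp add: algebra_simps)
  also have "\<bar>\<dots>\<bar> \<le> \<bar>t - c\<bar> * \<bar>stein z t\<bar> + \<bar>c\<bar> * \<bar>stein z t - stein z c\<bar>"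
    by (metis abs_mult abs_triangle_ineq)
  also have "\<dots> \<le> \<bar>t - c\<bar> * 6 + \<bar>c\<bar> * (2 * \<bar>t - c\<bar>)"
    using stein_bound stein_lipschitz by (intro add_mono mult_left_mono) auto
  finally show ?thesis by (simp add: algebra_simps)
qed

end

lemma Phi_lipschitz: "\<bar>Phi y - Phi x\<bar> \<le> \<bar>y - x\<bar>"
proof -
  have *: "\<bar>Phi y - Phi x\<bar> \<le> \<bar>y - x\<bar>" if "x < y" for x y
  proof -
    have "\<exists>t>x. t < y \<and> Phi y - Phi x = (y - x) * std_normal_density t"
      using DERIV_Phi that by (intro MVT2) auto
    then obtain t where t: "Phi y - Phi x = (y - x) * std_normal_density t"
      by blast
    have "std_normal_density t \<le> 1 / sqrt (2*pi) * 1"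
      unfolding std_normal_density_def by (intro mult_left_mono) auto
    also have "\<dots> \<le> 1" using pi_ge_two by simp
    finally have "std_normal_density t \<le> 1" .
    moreover have "0 \<le> std_normal_density t" by (simp add: std_normal_density_def)
    ultimately show ?thesis unfolding t using that by (simp add: abs_mult mult_left_le)
  qed
  consider "x < y" | "y < x" | "x = y" by linarith
  then show ?thesis by cases (use *[of x y] *[of y x] in auto)
qed

subsection \<open>A Berry--Esseen bound for weighted Bernoulli sums\<close>

text \<open>Increments of \<open>stein z\<close> are compared with \<open>W * f W\<close>. Replacing
  a point of the increment interval by \<open>W\<close> costs at most
  \<open>(6 + 2 * \<bar>W\<bar>) * \<delta>\<close>, in mean at most \<open>9 * \<delta>\<close>;
  shifting the threshold costs one more \<open>\<delta>\<close>. The defect of \<open>V\<close>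
  appears because the weights \<open>p i * (1 - p i) * (w i)\<^sup>2\<close> add up to
  \<open>V\<close>, not to \<open>1\<close>.\<close>

theorem berry_esseen_bernoulli:
  fixes p w :: "'a \<Rightarrow> real" and J :: "'a set" and \<delta> z :: real
  assumes fin: "finite J" and p01: "\<And>j. j \<in> J \<Longrightarrow> 0 \<le> p j \<and> p j \<le> 1"
    and w: "\<And>j. j \<in> J \<Longrightarrow> 0 \<le> w j \<and> w j \<le> \<delta>" and \<delta>: "\<delta> \<ge> 0"
  defines "V \<equiv> \<Sum>j\<in>J. p j * (1 - p j) * (w j)\<^sup>2"
  assumes V: "\<bar>V - 1\<bar> \<le> 1/2"
  shows "\<bar>bern_exp p J (\<lambda>A. of_bool ((\<Sum>j\<in>A. w j) - (\<Sum>j\<in>J. p j * w j) \<le> z)) - Phi z\<bar>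
      \<le> 10 * \<delta> + 2 * \<bar>V - 1\<bar>"
proof -
  define W where "W = (\<lambda>A. (\<Sum>j\<in>A. w j) - (\<Sum>j\<in>J. p j * w j))"
  have Wdel: "W (A - {i}) = (if i \<in> A then W A - w i else W A)"
    and Wins: "W (insert i A) = (if i \<in> A then W A else W A + w i)" if "A \<subseteq> J" for A i
  proof -
    have "finite A" using that fin finite_subset by blast
    then show "W (A - {i}) = (if i \<in> A then W A - w i else W A)"
      "W (insert i A) = (if i \<in> A then W A else W A + w i)"
      unfolding W_def by (auto simp: sum_diff1 insert_absorb)
  qed
  have Wsum: "W A = (\<Sum>j\<in>J. (of_bool (j \<in> A) - p j) * w j)" if "A \<subseteq> J" for A
  proof -
    have "(\<Sum>j\<in>A. w j) = (\<Sum>j\<in>J. of_bool (j \<in> A) * w j)"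
      using that fin by (intro sum.mono_neutral_cong_left) auto
    then show ?thesis unfolding W_def by (simp add: left_diff_distrib sum_subtractf)
  qed
  let ?E = "bern_exp p J"
  note mono = bern_exp_mono[OF fin p01]
  note bounds = bern_exp_bounds[OF fin p01]
  text \<open>Each increment of \<open>f\<close> is \<open>w i\<close> times the mean of its derivative over an interval, so this is the
    zero-bias identity without a zero-biased variable.\<close>
  have zero_bias: "?E (\<lambda>A. W A * f (W A)) =
     (\<Sum>i\<in>J. p i * (1 - p i) * w i * ?E (\<lambda>A. f (W (insert i A)) - f (W (A - {i}))))" for f
  proof -
    have "?E (\<lambda>A. W A * f (W A)) = ?E (\<lambda>A. \<Sum>i\<in>J. w i * ((of_bool (i \<in> A) - p i) * f (W A)))"
      by (intro bern_exp_cong) (simp add: Wsum sum_distrib_right algebra_simps)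
    also have "\<dots> = (\<Sum>i\<in>J. w i * ?E (\<lambda>A. (of_bool (i \<in> A) - p i) * f (W A)))"
      by (simp only: bern_exp_sum bern_exp_cmult)
    also have "\<dots> = (\<Sum>i\<in>J. p i * (1 - p i) * w i * ?E (\<lambda>A. f (W (insert i A)) - f (W (A - {i}))))"
      by (intro sum.cong refl) (subst bern_exp_centered[OF fin p01], auto)
    finally show ?thesis .
  qed
  have coef: "0 \<le> p i * (1 - p i) * w i" if "i \<in> J" for i using p01 w that by simp
  \<comment> \<open>The identity function in \<open>zero_bias\<close>, whose increments are all
    equal to \<open>w i\<close>.\<close>
  have var: "?E (\<lambda>A. (W A)\<^sup>2) = V"
  proof -
    have "?E (\<lambda>A. W (insert i A) - W (A - {i})) = w i" for i
      by (subst bern_exp_cong[where h="\<lambda>A. w i"]) (auto simp: Wdel Wins bern_exp_const[OF fin])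
    then show ?thesis using zero_bias[of "\<lambda>x. x"] by (simp add: V_def power2_eq_square mult.assoc)
  qed
  have EW: "?E (\<lambda>A. \<bar>W A\<bar>) \<le> (1 + V) / 2"
  proof -
    have "\<bar>x\<bar> \<le> (1/2) + (1/2) * x\<^sup>2" for x :: real
    proof -
      have "0 \<le> (\<bar>x\<bar> - 1)\<^sup>2" by simp
      then show ?thesis by (simp add: power2_diff)
    qed
    then have "?E (\<lambda>A. \<bar>W A\<bar>) \<le> ?E (\<lambda>A. (1/2) + (1/2) * (W A)\<^sup>2)" by (intro mono) auto
    also have "\<dots> = (1 + V) / 2"
      by (simp only: bern_exp_add bern_exp_cmult bern_exp_const[OF fin] var) simp
    finally show ?thesis .
  qed
  define \<eta> where "\<eta> = ?E (\<lambda>A. (6 + 2 * \<bar>W A\<bar>) * \<delta>)"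
  \<comment> \<open>\<open>V \<le> 3 / 2\<close> bounds the mean of \<open>\<bar>W A\<bar>\<close>
    by \<open>5 / 4\<close>, and \<open>6 + 5 / 2 \<le> 9\<close>.\<close>
  have \<eta>: "\<eta> \<le> 9 * \<delta>"
  proof -
    have "(\<lambda>A. (6 + 2 * \<bar>W A\<bar>) * \<delta>) = (\<lambda>A. 6 * \<delta> + (2 * \<delta>) * \<bar>W A\<bar>)"
      by (simp add: algebra_simps)
    then have "\<eta> = 6 * \<delta> + (2 * \<delta>) * ?E (\<lambda>A. \<bar>W A\<bar>)"
      by (simp only: \<eta>_def bern_exp_add bern_exp_cmult bern_exp_const[OF fin])
    also have "\<dots> \<le> 6 * \<delta> + (2 * \<delta>) * (5/4)"
    proof (intro add_left_mono mult_left_mono)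
      have "V \<le> 3/2" using V by linarith
      then show "?E (\<lambda>A. \<bar>W A\<bar>) \<le> 5/4" by (intro order_trans[OF EW]) simp
    qed (use \<delta> in simp)
    finally show ?thesis using \<delta> by simp
  qed
  \<comment> \<open>Both halves concern a shifted threshold; instantiating them at
    \<open>z - \<delta>\<close> and \<open>z + \<delta>\<close> brings it back to
    \<open>z\<close>.\<close>
  have main: "Phi z - (9 * \<delta> + 2 * \<bar>V - 1\<bar>) \<le> ?E (\<lambda>A. of_bool (W A \<le> z + \<delta>)) \<and>
      ?E (\<lambda>A. of_bool (W A \<le> z - \<delta>)) \<le> Phi z + (9 * \<delta> + 2 * \<bar>V - 1\<bar>)" for z
  proof -
    define f where "f = stein z"
    define m where "m = ?E (\<lambda>A. W A * f (W A))"
    have path: "f (W (insert i A)) - f (W (A - {i}))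
        \<le> w i * (W A * f (W A) + (6 + 2 * \<bar>W A\<bar>) * \<delta> + of_bool (W A \<le> z + \<delta>) - Phi z) \<and>
       w i * (W A * f (W A) - (6 + 2 * \<bar>W A\<bar>) * \<delta> + of_bool (W A \<le> z - \<delta>) - Phi z)
        \<le> f (W (insert i A)) - f (W (A - {i}))" if A: "A \<subseteq> J" and i: "i \<in> J" for A i
    proof -
      let ?a = "W (A - {i})" and ?b = "W (insert i A)" and ?c = "W A"
      let ?h = "(6 + 2 * \<bar>?c\<bar>) * \<delta>"
      have ab: "?b - ?a = w i" "?c \<le> ?b" "?a \<le> ?c" using w[OF i] by (auto simp: Wdel Wins A)
      have wi: "0 \<le> w i" "w i \<le> \<delta>" using w[OF i] by auto
      have near: "\<bar>t * f t - ?c * f ?c\<bar> \<le> ?h" if "?a \<le> t" "t \<le> ?b" for t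
      proof -
        have "\<bar>t * f t - ?c * f ?c\<bar> \<le> (6 + 2 * \<bar>?c\<bar>) * \<bar>t - ?c\<bar>"
          unfolding f_def by (rule stein_product_increment)
        also have "\<dots> \<le> ?h" using that ab wi by (intro mult_left_mono) (auto simp: abs_le_iff)
        finally show ?thesis .
      qed
      have "f ?b - f ?a \<le> (?c * f ?c + ?h + of_bool (?a \<le> z) - Phi z) * (?b - ?a)"
        unfolding f_def
      proof (rule stein_increment_le)
        fix t assume "?a \<le> t" "t \<le> ?b"
        then show "t * stein z t \<le> ?c * stein z ?c + ?h" using near[of t] unfolding f_def by linarith
      qed (use ab in linarith)
      \<comment> \<open>Since \<open>?c \<le> ?a + \<delta>\<close>, \<open>?a \<le> z\<close>
        implies \<open>?c \<le> z + \<delta>\<close>; dually, \<open>?c \<le> z - \<delta>\<close>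
        implies \<open>?b \<le> z\<close> in the lower bound.\<close>
      also have "\<dots> \<le> (?c * f ?c + ?h + of_bool (?c \<le> z + \<delta>) - Phi z) * (?b - ?a)"
        using ab wi by (intro order_refl mult_right_mono add_mono diff_mono) (auto simp: of_bool_def)
      finally have 1: "f ?b - f ?a \<le> w i * (?c * f ?c + ?h + of_bool (?c \<le> z + \<delta>) - Phi z)"
        unfolding ab by (simp add: mult.commute)
      have "(?c * f ?c - ?h + of_bool (?c \<le> z - \<delta>) - Phi z) * (?b - ?a)
          \<le> (?c * f ?c - ?h + of_bool (?b \<le> z) - Phi z) * (?b - ?a)"
        using ab wi by (intro order_refl mult_right_mono add_mono diff_mono) (auto simp: of_bool_def)
      also have "\<dots> \<le> f ?b - f ?a"
        unfolding f_def
      proof (rule stein_increment_ge)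
        fix t assume "?a \<le> t" "t \<le> ?b"
        then show "?c * stein z ?c - ?h \<le> t * stein z t" using near[of t] unfolding f_def by linarith
      qed (use ab in linarith)
      finally have 2: "w i * (?c * f ?c - ?h + of_bool (?c \<le> z - \<delta>) - Phi z) \<le> f ?b - f ?a"
        unfolding ab by (simp add: mult.commute)
      show ?thesis using 1 2 by blast
    qed
    have "m \<le> (\<Sum>i\<in>J. p i * (1 - p i) * w i * ?E (\<lambda>A. w i * (W A * f (W A) + (6 + 2 * \<bar>W A\<bar>) * \<delta>
          + of_bool (W A \<le> z + \<delta>) - Phi z)))"
      unfolding m_def zero_bias using path coef by (intro sum_mono mult_left_mono mono) auto
    also have "\<dots> = V * (m + \<eta> + ?E (\<lambda>A. of_bool (W A \<le> z + \<delta>)) - Phi z)"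
      by (simp only: bern_exp_cmult bern_exp_add bern_exp_diff bern_exp_const[OF fin] m_def \<eta>_def)
        (simp add: V_def sum_distrib_right power2_eq_square mult.assoc)
    finally have up: "m \<le> V * (m + \<eta> + ?E (\<lambda>A. of_bool (W A \<le> z + \<delta>)) - Phi z)" .
    have "V * (m - \<eta> + ?E (\<lambda>A. of_bool (W A \<le> z - \<delta>)) - Phi z)
       = (\<Sum>i\<in>J. p i * (1 - p i) * w i * ?E (\<lambda>A. w i * (W A * f (W A) - (6 + 2 * \<bar>W A\<bar>) * \<delta>
          + of_bool (W A \<le> z - \<delta>) - Phi z)))"
      by (simp only: bern_exp_cmult bern_exp_add bern_exp_diff bern_exp_const[OF fin] m_def \<eta>_def)
        (simp add: V_def sum_distrib_right power2_eq_square mult.assoc)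
    also have "\<dots> \<le> m"
      unfolding m_def zero_bias using path coef by (intro sum_mono mult_left_mono mono) auto
    finally have lo: "V * (m - \<eta> + ?E (\<lambda>A. of_bool (W A \<le> z - \<delta>)) - Phi z) \<le> m" .
    have m1: "\<bar>m\<bar> \<le> 1"
    proof -
      have s: "-1 \<le> W A * f (W A)" "W A * f (W A) \<le> 1" for A
        using stein_bound(2)[of "W A" z] unfolding f_def by linarith+
      have "-1 \<le> m" unfolding m_def by (rule bounds(1)[where u=1]) (use s in auto)
      moreover have "m \<le> 1" unfolding m_def by (rule bounds(2)[where l="-1"]) (use s in auto)
      ultimately show ?thesis by linarith
    qed
    have V0: "V \<ge> 1/2" "V > 0" using V by linarith+
    \<comment> \<open>After division by \<open>V\<close> the terms \<open>m / V\<close> and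
      \<open>m\<close> cancel only up to the variance defect.\<close>
    have "\<bar>m / V - m\<bar> = \<bar>m\<bar> * \<bar>V - 1\<bar> / V"
    proof -
      have "m / V - m = m * (1 - V) / V" using V0 by (simp add: field_simps)
      then show ?thesis using V0 by (simp add: abs_mult abs_minus_commute)
    qed
    also have "\<dots> \<le> 1 * \<bar>V - 1\<bar> / (1/2)"
      using m1 V0 by (intro frac_le mult_right_mono) auto
    finally have mV: "\<bar>m / V - m\<bar> \<le> 2 * \<bar>V - 1\<bar>" by simp
    have "m / V \<le> m + \<eta> + ?E (\<lambda>A. of_bool (W A \<le> z + \<delta>)) - Phi z"
      using up V0 by (simp add: field_simps)
    moreover have "m - \<eta> + ?E (\<lambda>A. of_bool (W A \<le> z - \<delta>)) - Phi z \<le> m / V"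
      using lo V0 by (simp add: field_simps)
    ultimately show ?thesis using mV \<eta> by linarith
  qed
  have "\<bar>?E (\<lambda>A. of_bool (W A \<le> z)) - Phi z\<bar> \<le> 10 * \<delta> + 2 * \<bar>V - 1\<bar>"
    using conjunct1[OF main[of "z - \<delta>"]] conjunct2[OF main[of "z + \<delta>"]]
      Phi_lipschitz[of z "z - \<delta>"] Phi_lipschitz[of z "z + \<delta>"] \<delta> by simp
  then show ?thesis unfolding W_def .
qed

section \<open>The involution count along the Feller coupling\<close>

text \<open>Weight \<open>\<theta>\<close> for closing the cycle against \<open>j - 1\<close> ways
  of continuing it, with \<open>j\<close> points left. Success at \<open>j = 1\<close> is
  certain.\<close>

definition feller_prob :: "real \<Rightarrow> nat \<Rightarrow> real" where
  "feller_prob \<theta> j = \<theta> / (\<theta> + real j - 1)"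

lemma feller_prob_bounds:
  assumes "\<theta> > 0" "j \<ge> 1"
  shows "0 \<le> feller_prob \<theta> j" "feller_prob \<theta> j \<le> 1" "feller_prob \<theta> j \<le> max 1 \<theta> / real j"
proof -
  have j: "real j \<ge> 1" using assms by simp
  have pos: "\<theta> + real j - 1 > 0" using assms j by linarith
  show "0 \<le> feller_prob \<theta> j" "feller_prob \<theta> j \<le> 1"
    using assms pos j by (auto simp: feller_prob_def)
  have "\<theta> * real j \<le> max 1 \<theta> * (\<theta> + real j - 1)"
  proof (cases "\<theta> \<ge> 1")
    case True then show ?thesis using assms by (simp add: max_def)
  next
    case False
    have "0 \<le> (1 - \<theta>) * (real j - 1)" using False j by simp
    then show ?thesis using False by (simp add: max_def algebra_simps)
  qed
  then show "feller_prob \<theta> j \<le> max 1 \<theta> / real j"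
    unfolding feller_prob_def using pos assms by (simp add: field_simps)
qed

lemma feller_sum_eq_bern_exp:
  assumes "\<theta> > 0"
  shows "feller_sum \<theta> n g / pochhammer \<theta> n = bern_exp (feller_prob \<theta>) {1..n} g"
proof -
  let ?q = "\<lambda>j. \<theta> + real j - 1"
  have pos: "?q j > 0" if "j \<in> {1..n}" for j using assms that by (auto simp: Suc_le_eq)
  have poch: "pochhammer \<theta> n = (\<Prod>j\<in>{1..n}. ?q j)"
    unfolding pochhammer_prod
    by (rule prod.reindex_bij_witness[of _ "\<lambda>j. j - 1" Suc]) (auto simp: of_nat_diff)
  have "\<theta> ^ card A * (\<Prod>j\<in>{1..n}-A. real j - 1) / pochhammer \<theta> n
     = (\<Prod>j\<in>A. feller_prob \<theta> j) * (\<Prod>j\<in>{1..n}-A. 1 - feller_prob \<theta> j)" if A: "A \<subseteq> {1..n}" for A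
  proof -
    have "(\<Prod>j\<in>{1..n}-A. 1 - feller_prob \<theta> j) = (\<Prod>j\<in>{1..n}-A. (real j - 1) / ?q j)"
    proof (rule prod.cong[OF refl])
      fix j assume "j \<in> {1..n} - A"
      then have "?q j > 0" using pos by auto
      then show "1 - feller_prob \<theta> j = (real j - 1) / ?q j"
        unfolding feller_prob_def by (simp add: field_simps)
    qed
    moreover have "(\<Prod>j\<in>{1..n}. ?q j) = (\<Prod>j\<in>A. ?q j) * (\<Prod>j\<in>{1..n}-A. ?q j)"
      using prod.subset_diff[OF A, of ?q] by (simp add: mult.commute)
    ultimately show ?thesis
      unfolding poch feller_prob_def by (simp add: prod_dividef)
  qed
  then show ?thesis
    unfolding feller_sum_def bern_exp_def sum_divide_distrib
    by (intro sum.cong refl) (metis PowD times_divide_eq_left)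
qed

lemma num_cycles_eq: "num_cycles n \<sigma> = size (cycle_type {1..n} \<sigma>)"
  by (simp add: num_cycles_def perm_cycles_def cycle_type_def)

lemma cycle_count_eq: "cycle_count n \<sigma> = count (cycle_type {1..n} \<sigma>)"
proof
  fix k
  let ?X = "perm_orbit \<sigma> ` {1..n}"
  have "count (cycle_type {1..n} \<sigma>) k = (\<Sum>c\<in>card -` {k} \<inter> ?X. count (mset_set ?X) c)"
    by (simp add: cycle_type_def count_image_mset)
  also have "\<dots> = card (card -` {k} \<inter> ?X)" by simp
  also have "card -` {k} \<inter> ?X = {c \<in> ?X. card c = k}" by auto
  finally show "cycle_count n \<sigma> k = count (cycle_type {1..n} \<sigma>) k"
    by (simp add: cycle_count_def perm_cycles_def)
qed

theorem ewens_prob_feller: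
  assumes "\<theta> > 0"
  shows "ewens_prob \<theta> n (\<lambda>\<sigma>. Q (cycle_count n \<sigma>))
     = bern_exp (feller_prob \<theta>) {1..n} (\<lambda>A. of_bool (Q (count (spacings n 0 A))))"
proof -
  have fin: "finite {\<sigma>. \<sigma> permutes {1..n}}" by (simp add: finite_permutations)
  have "(\<Sum>\<sigma>\<in>{\<sigma>. \<sigma> permutes {1..n} \<and> Q (cycle_count n \<sigma>)}. \<theta> ^ num_cycles n \<sigma>)
     = (\<Sum>\<sigma> | \<sigma> permutes {1..n}. \<theta> ^ size (cycle_type {1..n} \<sigma>) *
          of_bool (Q (count (cycle_type {1..n} \<sigma>))))"
    using fin by (intro sum.mono_neutral_cong_left) (auto simp: num_cycles_eq cycle_count_eq)
  also have "\<dots> = feller_sum \<theta> n (\<lambda>A. of_bool (Q (count (spacings n 0 A))))"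
    using cycle_type_permutations_sum(1)[of "{1..n}" n \<theta> "\<lambda>M. of_bool (Q (count M))"] by simp
  finally show ?thesis
    unfolding ewens_prob_def by (simp only: feller_sum_eq_bern_exp[OF assms])
qed

subsection \<open>The involution factor\<close>

lemma falling_Suc: "falling a (Suc r) = falling a r * (real a - real r)"
  by (simp add: falling_def)

lemma falling_Suc_Suc: "falling (Suc a) (Suc r) = real (Suc a) * falling a r"
  unfolding falling_def by (subst prod.lessThan_Suc_shift) simp

lemma falling_eq_0: "a < r \<Longrightarrow> falling a r = 0"
  unfolding falling_def by (auto intro: prod_zero)

lemma falling_nonneg: "falling a r \<ge> 0"
proof (cases "r \<le> a")
  case True then show ?thesis unfolding falling_def by (intro prod_nonneg) auto
qed (simp add: falling_eq_0)

text \<open>A sum over partial matchings of \<open>a\<close> points with weight \<open>1 / k\<close>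
  per pair: \<open>falling a (2*j) / (2 ^ j * fact j)\<close> counts those with \<open>j\<close>
  pairs.\<close>

definition invol_factor :: "nat \<Rightarrow> nat \<Rightarrow> real" where
  "invol_factor k a = (\<Sum>j=0..a div 2. falling a (2*j) / (real (2*k) ^ j * fact j))"

text \<open>Terms beyond \<open>a div 2\<close> vanish, so sums for different \<open>a\<close> can
  share one range and be compared termwise.\<close>

lemma invol_factor_eq:
  assumes "a div 2 \<le> N"
  shows "invol_factor k a = (\<Sum>j\<le>N. falling a (2*j) / (real (2*k) ^ j * fact j))"
  unfolding invol_factor_def using assms
  by (intro sum.mono_neutral_left) (auto simp: falling_eq_0)

text \<open>In a matching, the last point is unmatched or matched with one of the
  \<open>Suc b\<close> others; on coefficients this is an identity between falling
  factorials.\<close>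

lemma invol_factor_rec:
  assumes "k \<ge> 1"
  shows "invol_factor k (Suc (Suc b))
     = invol_factor k (Suc b) + real (Suc b) / real k * invol_factor k b"
proof -
  let ?t = "\<lambda>a j. falling a (2*j) / (real (2*k) ^ j * fact j)"
  let ?N = "Suc b"
  have step: "?t (Suc (Suc b)) (Suc i) = ?t (Suc b) (Suc i) + real (Suc b) / real k * ?t b i" for i
  proof -
    have s: "2 * Suc i = Suc (Suc (2 * i))" by simp
    have "falling (Suc (Suc b)) (2 * Suc i) = falling (Suc b) (2 * Suc i)
        + 2 * real (Suc i) * (real (Suc b) * falling b (2*i))"
      unfolding s falling_Suc_Suc[of "Suc b" "Suc (2*i)"] falling_Suc[of "Suc b" "Suc (2*i)"]
        falling_Suc_Suc[of b "2*i"]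
      by (simp add: algebra_simps)
    moreover have "2 * real (Suc i) * x / (real (2*k) ^ Suc i * fact (Suc i))
        = x / real k / (real (2*k) ^ i * fact i)" for x
    proof -
      have cancel: "2 * r * x / ((2 * q * P) * (r * F)) = x / q / (P * F)"
        if "r \<noteq> 0" "q \<noteq> 0" "P \<noteq> 0" "F \<noteq> 0" for r q P F :: real
        using that by (simp add: divide_simps)
      have "real (2*k) ^ Suc i = 2 * real k * real (2*k) ^ i" "fact (Suc i) = real (Suc i) * fact i"
        by simp_all
      then show ?thesis
        using cancel[of "real (Suc i)" "real k" "real (2*k) ^ i" "fact i"] assms
        by (simp only:) simp
    qed
    moreover have "c * f / d / P = c / d * (f / P)" for c f d P :: real by simp
    ultimately show ?thesis by (simp only: add_divide_distrib)
  qed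
  have "invol_factor k (Suc (Suc b)) = (\<Sum>j\<le>Suc ?N. ?t (Suc (Suc b)) j)"
    by (rule invol_factor_eq) simp
  also have "\<dots> = ?t (Suc (Suc b)) 0 + (\<Sum>i\<le>?N. ?t (Suc (Suc b)) (Suc i))"
    by (rule sum.atMost_Suc_shift)
  also have "\<dots> = (?t (Suc b) 0 + (\<Sum>i\<le>?N. ?t (Suc b) (Suc i))) + real (Suc b) / real k * (\<Sum>i\<le>?N. ?t b i)"
    unfolding step sum.distrib sum_distrib_left by (simp add: falling_def)
  also have "?t (Suc b) 0 + (\<Sum>i\<le>?N. ?t (Suc b) (Suc i)) = (\<Sum>j\<le>Suc ?N. ?t (Suc b) j)"
    by (rule sum.atMost_Suc_shift[symmetric])
  also have "\<dots> = invol_factor k (Suc b)" by (rule invol_factor_eq[symmetric]) simp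
  also have "(\<Sum>i\<le>?N. ?t b i) = invol_factor k b" by (rule invol_factor_eq[symmetric]) simp
  finally show ?thesis .
qed

lemma invol_factor_small: "invol_factor k 0 = 1" "invol_factor k (Suc 0) = 1"
  by (simp_all add: invol_factor_def falling_def)

lemma invol_factor_ge_1: "invol_factor k a \<ge> 1"
proof -
  have "falling a (2*0) / (real (2*k) ^ 0 * fact 0) \<le> invol_factor k a"
    unfolding invol_factor_def
    by (rule member_le_sum) (auto intro!: divide_nonneg_nonneg falling_nonneg)
  then show ?thesis by (simp add: falling_def)
qed

lemma invol_factor_Suc:
  assumes "k \<ge> 1"
  shows "invol_factor k a \<le> invol_factor k (Suc a)"
    "invol_factor k (Suc a) \<le> invol_factor k a * (1 + real a / real k)"
proof -
  have mono: "invol_factor k a \<le> invol_factor k (Suc a)" for a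
  proof (cases a)
    case (Suc b)
    have "0 \<le> real (Suc b) / real k * invol_factor k b"
      using invol_factor_ge_1[of k b] by (intro mult_nonneg_nonneg) auto
    then show ?thesis unfolding Suc invol_factor_rec[OF assms] by simp
  qed (simp add: invol_factor_small)
  then show "invol_factor k a \<le> invol_factor k (Suc a)" .
  show "invol_factor k (Suc a) \<le> invol_factor k a * (1 + real a / real k)"
  proof (cases a)
    case (Suc b)
    have "real (Suc b) / real k * invol_factor k b \<le> real (Suc b) / real k * invol_factor k (Suc b)"
      using mono by (intro mult_left_mono) auto
    then show ?thesis unfolding Suc invol_factor_rec[OF assms] by (simp add: algebra_simps)
  qed (simp add: invol_factor_small)
qed

text \<open>Accumulated bounds on the growth ratios of \<open>invol_factor\<close>. Raising a count
  by one adds a single logarithm, which later isolates the topmost spacing.\<close>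

definition invol_excess :: "nat \<Rightarrow> nat \<Rightarrow> real" where
  "invol_excess k a = (\<Sum>i<a. ln (1 + real i / real k))"

lemma ln_invol_factor_le:
  assumes "k \<ge> 1" shows "ln (invol_factor k a) \<le> invol_excess k a"
proof (induction a)
  case 0 show ?case by (simp add: invol_factor_small invol_excess_def)
next
  case (Suc a)
  have pos: "invol_factor k b > 0" for b using invol_factor_ge_1[of k b] by linarith
  have pos2: "1 + real a / real k > 0" by (simp add: add_pos_nonneg)
  have "ln (invol_factor k (Suc a)) \<le> ln (invol_factor k a * (1 + real a / real k))"
    using invol_factor_Suc(2)[OF assms, of a] pos[of "Suc a"] mult_pos_pos[OF pos[of a] pos2]
    by (subst ln_le_cancel_iff)
  also have "\<dots> = ln (invol_factor k a) + ln (1 + real a / real k)"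
    by (rule ln_mult_pos) (use pos[of a] pos2 in auto)
  finally show ?case using Suc by (simp add: invol_excess_def)
qed

lemma invol_excess_mono: "a \<le> b \<Longrightarrow> invol_excess k a \<le> invol_excess k b"
  unfolding invol_excess_def by (intro sum_mono2) auto

lemma invol_excess_le: "invol_excess k a \<le> (real a)\<^sup>2 / (2 * real k)"
proof -
  have "invol_excess k a \<le> (\<Sum>i<a. real i / real k)"
    unfolding invol_excess_def by (intro sum_mono ln_add_one_self_le_self) auto
  also have "\<dots> = (\<Sum>i<a. real i) / real k" by (simp add: sum_divide_distrib)
  also have "\<dots> \<le> ((real a)\<^sup>2 / 2) / real k"
  proof (intro divide_right_mono)
    show "(\<Sum>i<a. real i) \<le> (real a)\<^sup>2 / 2"
      by (induction a) (auto simp: power2_eq_square field_simps)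
  qed simp
  finally show ?thesis by simp
qed

lemma ln_invol_bounds:
  "(\<Sum>k=1..n. real (a k) * ln (real k)) \<le> ln (invol n a)"
  "ln (invol n a) \<le> (\<Sum>k=1..n. real (a k) * ln (real k)) + (\<Sum>k=1..n. invol_excess k (a k))"
proof -
  have pos: "invol_factor k b > 0" for k b using invol_factor_ge_1[of k b] by linarith
  have nz: "invol_factor k b \<noteq> 0" for k b using pos[of k b] by linarith
  have "ln (invol n a) = (\<Sum>k=1..n. ln (real k ^ a k * invol_factor k (a k)))"
    unfolding invol_def invol_factor_def[symmetric]
    by (intro ln_prod) (use nz in auto)
  also have "\<dots> = (\<Sum>k=1..n. real (a k) * ln (real k) + ln (invol_factor k (a k)))"
    by (intro sum.cong refl) (subst ln_mult, use nz in \<open>auto simp: ln_realpow\<close>)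
  finally have eq: "ln (invol n a) = (\<Sum>k=1..n. real (a k) * ln (real k)) + (\<Sum>k=1..n. ln (invol_factor k (a k)))"
    by (simp add: sum.distrib)
  show "(\<Sum>k=1..n. real (a k) * ln (real k)) \<le> ln (invol n a)"
    unfolding eq using invol_factor_ge_1 by (simp add: sum_nonneg)
  show "ln (invol n a) \<le> (\<Sum>k=1..n. real (a k) * ln (real k)) + (\<Sum>k=1..n. invol_excess k (a k))"
    unfolding eq using ln_invol_factor_le by (intro add_left_mono sum_mono) auto
qed

subsection \<open>Pathwise comparison with a sum over the Feller points\<close>

lemma spacings_range: "x \<in># spacings m l A \<Longrightarrow> 1 \<le> x \<and> x \<le> m + l"
proof (induction m arbitrary: l)
  case (Suc m)
  show ?case
  proof (cases "Suc m \<in> A")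
    case True
    then have "x = Suc l \<or> x \<in># spacings m 0 A" using Suc.prems by auto
    then show ?thesis using Suc.IH[of 0] by auto
  next
    case False then show ?thesis using Suc.prems Suc.IH[of "Suc l"] by auto
  qed
qed simp

lemma sum_count_eq:
  fixes M :: "nat multiset"
  assumes "\<And>x. x \<in># M \<Longrightarrow> 1 \<le> x \<and> x \<le> n"
  shows "(\<Sum>k=1..n. real (count M k) * f k) = (\<Sum>x\<in>#M. f x)"
  using assms
proof (induction M)
  case (add x M)
  have x: "x \<in> {1..n}" using add.prems by auto
  have "(\<Sum>k=1..n. real (count (add_mset x M) k) * f k)
      = (\<Sum>k=1..n. real (count M k) * f k + (if k = x then f k else 0))"
    by (intro sum.cong refl) (auto simp: algebra_simps)
  also have "\<dots> = (\<Sum>k=1..n. real (count M k) * f k) + f x"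
    unfolding sum.distrib using x by (subst sum.delta) auto
  finally show ?case using add by simp
qed simp

text \<open>The loss from replacing the logarithm of a spacing by that of the position of its upper end.\<close>
fun spacing_loss :: "nat \<Rightarrow> nat \<Rightarrow> nat set \<Rightarrow> real" where
  "spacing_loss 0 l A = 0"
| "spacing_loss (Suc m) l A =
     (if Suc m \<in> A then ln (real (Suc (Suc (m + l))) / real (Suc l)) + spacing_loss m 0 A
      else spacing_loss m (Suc l) A)"

lemma spacing_loss_cong:
  "(\<And>j. 1 \<le> j \<Longrightarrow> j \<le> m \<Longrightarrow> j \<in> A \<longleftrightarrow> j \<in> B) \<Longrightarrow> spacing_loss m l A = spacing_loss m l B"
  by (induction m arbitrary: l) auto

lemma spacing_loss_nonneg: "spacing_loss m l A \<ge> 0"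
  by (induction m arbitrary: l) (auto intro!: add_nonneg_nonneg ln_ge_zero)

text \<open>Each spacing is charged to its upper end. The upper ends are the phantom point
  \<open>m + l + 1\<close> and all successes except the lowest, which is \<open>1\<close> and
  contributes \<open>ln 1 = 0\<close>.\<close>

lemma sum_ln_spacings:
  assumes "1 \<in> A" "m \<ge> 1"
  shows "(\<Sum>x\<in>#spacings m l A. ln (real x)) + spacing_loss m l A
     = ln (real (Suc (m + l))) + (\<Sum>j\<in>A \<inter> {1..m}. ln (real j))"
  using assms(2)
proof (induction m arbitrary: l rule: dec_induct)
  case base
  have "A \<inter> {1..1} = {1}" using assms by auto
  then show ?case using assms by (simp add: ln_div)
next
  case (step m)
  show ?case
  proof (cases "Suc m \<in> A")
    case True
    have "A \<inter> {1..Suc m} = insert (Suc m) (A \<inter> {1..m})" using True by auto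
    then have "(\<Sum>j\<in>A \<inter> {1..Suc m}. ln (real j)) = ln (real (Suc m)) + (\<Sum>j\<in>A \<inter> {1..m}. ln (real j))"
      by simp
    then show ?thesis using True step.IH[of 0] by (simp add: ln_div)
  next
    case False
    then have "A \<inter> {1..Suc m} = A \<inter> {1..m}" by (auto simp: le_Suc_eq)
    then show ?thesis using False step.IH[of "Suc l"] by simp
  qed
qed

text \<open>All pairs of successes at distance \<open>k\<close> are counted, not only consecutive
  ones: an overcount, but its second moment is a sum of explicit products.\<close>

definition pair_count :: "nat \<Rightarrow> nat \<Rightarrow> nat set \<Rightarrow> nat" where
  "pair_count m k A = card {i\<in>{1..m}. i + k \<le> m \<and> {i, i + k} \<subseteq> A}"

lemma pair_count_mono: "m \<le> m' \<Longrightarrow> pair_count m k A \<le> pair_count m' k A"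
  unfolding pair_count_def by (intro card_mono) auto

text \<open>Every spacing except the topmost, whose upper end is a phantom point, joins two
  successes. The facts on \<open>g\<close> serve the induction: once \<open>Suc m\<close> is a
  success, the spacing \<open>g\<close> beneath it becomes the pair \<open>Suc m - g\<close>,
  \<open>Suc m\<close>.\<close>

lemma spacings_top:
  assumes "A \<inter> {1..m} \<noteq> {}"
  obtains g I where "spacings m l A = add_mset g I" "1 \<le> g" "g \<le> m + l" "l < g"
    "Suc (m + l) - g \<in> A" "\<And>k. count I k \<le> pair_count m k A"
  using assms
proof (induction m arbitrary: l thesis)
  case (Suc m)
  show ?case
  proof (cases "Suc m \<in> A")
    case False
    then have "A \<inter> {1..m} \<noteq> {}" using Suc.prems(2) by (auto simp: le_Suc_eq)
    then obtain g I where g: "spacings m (Suc l) A = add_mset g I" "1 \<le> g" "g \<le> m + Suc l" "Suc l < g"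
       "Suc (m + Suc l) - g \<in> A" "\<And>k. count I k \<le> pair_count m k A"
      using Suc.IH by blast
    show ?thesis
    proof (rule Suc.prems(1))
      show "count I k \<le> pair_count (Suc m) k A" for k
        using g(6)[of k] pair_count_mono[of m "Suc m" k A] by simp
    qed (use g False in auto)
  next
    case True
    show ?thesis
    proof (cases "A \<inter> {1..m} = {}")
      case empty: True
      then have "spacings m 0 A = spacings m 0 {}" by (intro spacings_cong) auto
      also have "spacings m l' {} = {#}" for l' by (induction m arbitrary: l') auto
      finally show ?thesis
        using True by (intro Suc.prems(1)[of "Suc l" "{#}"]) auto
    next
      case False
      then obtain g I where g: "spacings m 0 A = add_mset g I" "1 \<le> g" "g \<le> m + 0" "0 < g"
         "Suc (m + 0) - g \<in> A" "\<And>k. count I k \<le> pair_count m k A"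
        using Suc.IH by blast
      show ?thesis
      proof (rule Suc.prems(1)[of "Suc l" "add_mset g I"])
        fix k
        show "count (add_mset g I) k \<le> pair_count (Suc m) k A"
        proof (cases "k = g")
          case False
          then show ?thesis using g(6)[of k] pair_count_mono[of m "Suc m" k A] by simp
        next
          case kg: True
          \<comment> \<open>The pair ending at \<open>Suc m\<close> is new, as
            \<open>pair_count m\<close> sees only pairs up to \<open>m\<close>.\<close>
          let ?P = "{i\<in>{1..m}. i + g \<le> m \<and> {i, i + g} \<subseteq> A}"
          have "insert (Suc m - g) ?P \<subseteq> {i\<in>{1..Suc m}. i + g \<le> Suc m \<and> {i, i + g} \<subseteq> A}"
            using g True by auto
          then have "card (insert (Suc m - g) ?P) \<le> pair_count (Suc m) g A"
            unfolding pair_count_def by (intro card_mono) auto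
          moreover have "Suc m - g \<notin> ?P" by auto
          ultimately show ?thesis using g(6)[of g] kg by (simp add: pair_count_def)
        qed
      qed (use g True in auto)
    qed
  qed
qed simp

definition pair_excess :: "nat \<Rightarrow> nat set \<Rightarrow> real" where
  "pair_excess n A = (\<Sum>k=1..n. (real (pair_count n k A))\<^sup>2 / (2 * real k))"

text \<open>The topmost spacing may coincide with others, but it enters only one cycle count and hence costs
  at most one factor \<open>1 + n\<close>.\<close>
lemma invol_excess_spacings:
  assumes "n \<ge> 1" "1 \<in> A"
  shows "(\<Sum>k=1..n. invol_excess k (count (spacings n 0 A) k)) \<le> ln (1 + real n) + pair_excess n A"
proof -
  have "A \<inter> {1..n} \<noteq> {}" using assms by auto
  then obtain g I where g: "spacings n 0 A = add_mset g I" "1 \<le> g" "g \<le> n"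
      "\<And>k. count I k \<le> pair_count n k A"
    using spacings_top[of A n 0] by (metis add.right_neutral)
  have "invol_excess k (count (spacings n 0 A) k)
     = invol_excess k (count I k) + (if k = g then ln (1 + real (count I g) / real g) else 0)" for k
    unfolding g(1) by (simp add: invol_excess_def)
  then have "(\<Sum>k=1..n. invol_excess k (count (spacings n 0 A) k))
     = (\<Sum>k=1..n. invol_excess k (count I k)) + ln (1 + real (count I g) / real g)"
    using g(2,3) by (simp add: sum.distrib)
  also have "ln (1 + real (count I g) / real g) \<le> ln (1 + real n)"
  proof -
    have "pair_count n g A \<le> card {1..n}" unfolding pair_count_def by (intro card_mono) auto
    then have "count I g \<le> n" using g(4)[of g] by simp
    then have "real (count I g) / real g \<le> real n / 1" using g(2) by (intro frac_le) auto
    then show ?thesis by (simp add: add_pos_nonneg)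
  qed
  also have "(\<Sum>k=1..n. invol_excess k (count I k)) \<le> pair_excess n A"
    unfolding pair_excess_def
  proof (intro sum_mono)
    fix k
    show "invol_excess k (count I k) \<le> (real (pair_count n k A))\<^sup>2 / (2 * real k)"
      using invol_excess_mono[OF g(4)[of k], of k] invol_excess_le[of k "pair_count n k A"] by linarith
  qed
  finally show ?thesis by simp
qed

text \<open>Of the two logarithms one is the phantom upper end in \<open>sum_ln_spacings\<close>,
  the other the cost of the topmost spacing in \<open>invol_excess_spacings\<close>.\<close>

lemma ln_invol_spacings:
  assumes "n \<ge> 1" "1 \<in> A" "A \<subseteq> {1..n}"
  shows "\<bar>ln (invol n (count (spacings n 0 A))) - (\<Sum>j\<in>A. ln (real j))\<bar>
     \<le> 2 * ln (1 + real n) + spacing_loss n 0 A + pair_excess n A"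
proof -
  let ?M = "spacings n 0 A"
  have A: "A \<inter> {1..n} = A" using assms by auto
  have "(\<Sum>k=1..n. real (count ?M k) * ln (real k)) = (\<Sum>x\<in>#?M. ln (real x))"
    by (rule sum_count_eq) (use spacings_range[of _ n 0 A] in auto)
  also have "\<dots> = ln (1 + real n) + (\<Sum>j\<in>A. ln (real j)) - spacing_loss n 0 A"
    using sum_ln_spacings[OF assms(2,1), of 0] unfolding A by simp
  finally have eq: "(\<Sum>k=1..n. real (count ?M k) * ln (real k))
      = ln (1 + real n) + (\<Sum>j\<in>A. ln (real j)) - spacing_loss n 0 A" .
  have "0 \<le> pair_excess n A" unfolding pair_excess_def by (intro sum_nonneg) auto
  moreover have "0 \<le> ln (1 + real n)" by simp
  ultimately show ?thesis
    using ln_invol_bounds[where n=n and a="count ?M"] invol_excess_spacings[OF assms(1,2)]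
      spacing_loss_nonneg[of n 0 A] unfolding eq by linarith
qed

subsection \<open>Expectation bounds\<close>

lemma bern_exp_atMost_Suc:
  assumes "\<And>A. A \<subseteq> {1..m} \<Longrightarrow> g (insert (Suc m) A) = g1 A" "\<And>A. A \<subseteq> {1..m} \<Longrightarrow> g A = g0 A"
  shows "bern_exp p {1..Suc m} g = p (Suc m) * bern_exp p {1..m} g1 + (1 - p (Suc m)) * bern_exp p {1..m} g0"
proof -
  have "{1..Suc m} = insert (Suc m) {1..m}" by auto
  then have "bern_exp p {1..Suc m} g = p (Suc m) * bern_exp p {1..m} (\<lambda>A. g (insert (Suc m) A))
      + (1 - p (Suc m)) * bern_exp p {1..m} g"
    by (simp add: bern_exp_insert)
  also have "bern_exp p {1..m} (\<lambda>A. g (insert (Suc m) A)) = bern_exp p {1..m} g1"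
    by (rule bern_exp_cong) (rule assms)
  also have "bern_exp p {1..m} g = bern_exp p {1..m} g0" by (rule bern_exp_cong) (rule assms)
  finally show ?thesis .
qed

section \<open>Exponential moment of the spacing loss\<close>

definition fourth_root :: "real \<Rightarrow> real" where "fourth_root x = sqrt (sqrt x)"

lemma fourth_root_pow4: "x \<ge> 0 \<Longrightarrow> fourth_root x ^ 4 = x"
  by (simp add: fourth_root_def power4_eq_xxxx)
    (metis mult.assoc real_sqrt_ge_0_iff real_sqrt_mult_self abs_of_nonneg)

lemma fourth_root_pos: "x > 0 \<Longrightarrow> fourth_root x > 0"
  by (simp add: fourth_root_def)

lemma fourth_root_nonneg: "x \<ge> 0 \<Longrightarrow> fourth_root x \<ge> 0"
  by (simp add: fourth_root_def)

lemma fourth_root_mono: "x \<le> y \<Longrightarrow> fourth_root x \<le> fourth_root y"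
  by (simp add: fourth_root_def)

lemma fourth_root_divide: "fourth_root (x / y) = fourth_root x / fourth_root y"
  by (simp add: fourth_root_def real_sqrt_divide)

lemma exp_ln_fourth: "x > 0 \<Longrightarrow> exp (ln x / 4) = fourth_root x"
proof -
  assume x: "x > 0"
  have "fourth_root x = exp (ln (fourth_root x))" using fourth_root_pos[OF x] by simp
  also have "ln (fourth_root x) = ln x / 4" using x by (simp add: fourth_root_def ln_sqrt)
  finally show ?thesis by simp
qed

text \<open>Telescoping: for consecutive fourth roots, \<open>1 = x ^ 4 - y ^ 4\<close> factors into
  \<open>x - y\<close> and four terms, each at most \<open>x ^ 3\<close>.\<close>

lemma sum_inverse_fourth_root_cubed:
  "(\<Sum>d=1..m. 1 / fourth_root (real d) ^ 3) \<le> 4 * fourth_root (real m)"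
proof (induction m)
  case 0 show ?case by (simp add: fourth_root_def)
next
  case (Suc m)
  define x y where "x = fourth_root (real (Suc m))" and "y = fourth_root (real m)"
  have x: "x > 0" and y: "0 \<le> y" "y \<le> x"
    unfolding x_def y_def by (auto intro: fourth_root_pos fourth_root_nonneg fourth_root_mono)
  have "1 = x ^ 4 - y ^ 4" unfolding x_def y_def by (simp add: fourth_root_pow4)
  also have "\<dots> = (x - y) * (x ^ 3 + x ^ 2 * y + x * y ^ 2 + y ^ 3)"
    by (simp add: algebra_simps power4_eq_xxxx power3_eq_cube power2_eq_square)
  also have "\<dots> \<le> (x - y) * (x ^ 3 + x ^ 2 * x + x * x ^ 2 + x ^ 3)"
    using x y by (intro mult_left_mono add_mono power_mono order_refl) auto
  also have "\<dots> = (x - y) * 4 * x ^ 3" by (simp add: power3_eq_cube power2_eq_square)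
  finally have "1 / x ^ 3 \<le> 4 * (x - y)" using x by (simp add: field_simps)
  then show ?case using Suc unfolding x_def y_def by simp
qed

text \<open>Bernoulli's inequality gives \<open>1 / (1 + \<kappa> * y)\<close>, and the
  arithmetic-geometric mean inequality trades this for separate powers. The factor
  \<open>1 / sqrt \<kappa>\<close> is what will close the moment recursion.\<close>

lemma one_minus_power_le:
  assumes "0 < y" "y < 1" "\<kappa> \<ge> 1"
  shows "(1 - y) ^ \<kappa> \<le> 1 / (2 * sqrt (real \<kappa>) * sqrt y)"
proof -
  have k: "real \<kappa> > 0" using assms by simp
  have "(1 - y) ^ \<kappa> * (1 + real \<kappa> * y) \<le> (1 - y) ^ \<kappa> * (1 + y) ^ \<kappa>"
    using assms by (intro mult_left_mono Bernoulli_inequality) auto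
  also have "\<dots> = (1 - y\<^sup>2) ^ \<kappa>"
    by (simp add: power_mult_distrib[symmetric] algebra_simps power2_eq_square)
  also have "\<dots> \<le> 1" using assms by (intro power_le_one) (auto simp: power_le_one)
  finally have 1: "(1 - y) ^ \<kappa> \<le> 1 / (1 + real \<kappa> * y)"
    using assms k by (simp add: field_simps add_pos_pos)
  have "0 \<le> (1 - sqrt (real \<kappa> * y))\<^sup>2" by simp
  then have "2 * sqrt (real \<kappa>) * sqrt y \<le> 1 + real \<kappa> * y"
    using assms by (simp add: power2_diff real_sqrt_mult power_mult_distrib)
  then have "1 / (1 + real \<kappa> * y) \<le> 1 / (2 * sqrt (real \<kappa>) * sqrt y)"
    using assms k by (intro divide_left_mono) (auto intro!: mult_pos_pos add_pos_pos)
  then show ?thesis using 1 by linarith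
qed

text \<open>A Riemann sum of the beta integral of \<open>x ^ \<kappa> * (1 - x) powr (- 1 / 4)\<close>, which is small for large \<open>\<kappa>\<close>.\<close>
lemma beta_sum_le:
  assumes "\<kappa> \<ge> 1"
  shows "(\<Sum>i=1..m. 1 / real (Suc m) * (real i / real (Suc m)) ^ \<kappa>
      * fourth_root (real (Suc m) / real (Suc m - i))) \<le> 2 / sqrt (real \<kappa>)"
proof -
  define j where "j = Suc m"
  let ?q = fourth_root
  have qj: "?q (real j) > 0" by (intro fourth_root_pos) (simp add: j_def)
  have sk: "sqrt (real \<kappa>) > 0" using assms by simp
  have "(\<Sum>i=1..m. 1 / real j * (real i / real j) ^ \<kappa> * ?q (real j / real (j - i)))
     = (\<Sum>d=1..m. 1 / real j * (real (j - d) / real j) ^ \<kappa> * ?q (real j / real d))"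
    by (rule sum.reindex_bij_witness[of _ "\<lambda>d. j - d" "\<lambda>i. j - i"]) (auto simp: j_def)
  \<comment> \<open>With \<open>y = d / j\<close>, the exponents \<open>1 / 2\<close> from the power
    bound and \<open>1 / 4\<close> from the moment add up to \<open>3 / 4 < 1\<close>, so the
    singularity at \<open>d = 0\<close> is summable.\<close>
  also have "\<dots> \<le> (\<Sum>d=1..m. (?q (real j) ^ 3 / (2 * sqrt (real \<kappa>) * real j)) * (1 / ?q (real d) ^ 3))"
  proof (rule sum_mono)
    fix d assume d: "d \<in> {1..m}"
    define y where "y = real d / real j"
    have y: "0 < y" "y < 1" using d by (auto simp: y_def j_def)
    have qy: "?q y > 0" using y by (simp add: fourth_root_pos)
    have "real (j - d) / real j = 1 - y" using d by (simp add: y_def j_def field_simps)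
    moreover have "real j / real d = 1 / y" using d by (simp add: y_def)
    ultimately have "1 / real j * (real (j - d) / real j) ^ \<kappa> * ?q (real j / real d)
        = 1 / real j * ((1 - y) ^ \<kappa> * (1 / ?q y))"
      by (simp add: fourth_root_divide) (simp add: fourth_root_def)
    also have "\<dots> \<le> 1 / real j * (1 / (2 * sqrt (real \<kappa>) * sqrt y) * (1 / ?q y))"
      using one_minus_power_le[OF y assms] qy by (intro mult_left_mono mult_right_mono) auto
    also have "\<dots> = 1 / (2 * sqrt (real \<kappa>) * real j) * (1 / ?q y ^ 3)"
    proof -
      have "sqrt y = ?q y ^ 2" unfolding fourth_root_def using y by simp
      then show ?thesis using qy sk by (simp add: power3_eq_cube power2_eq_square)
    qed
    also have "1 / ?q y ^ 3 = ?q (real j) ^ 3 / ?q (real d) ^ 3"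
      unfolding y_def fourth_root_divide by (simp add: power_divide)
    finally show "1 / real j * (real (j - d) / real j) ^ \<kappa> * ?q (real j / real d)
        \<le> (?q (real j) ^ 3 / (2 * sqrt (real \<kappa>) * real j)) * (1 / ?q (real d) ^ 3)" by simp
  qed
  also have "\<dots> = (?q (real j) ^ 3 / (2 * sqrt (real \<kappa>) * real j)) * (\<Sum>d=1..m. 1 / ?q (real d) ^ 3)"
    by (simp add: sum_distrib_left)
  also have "\<dots> \<le> (?q (real j) ^ 3 / (2 * sqrt (real \<kappa>) * real j)) * (4 * ?q (real j))"
  proof (intro mult_left_mono)
    have "?q (real m) \<le> ?q (real j)" by (intro fourth_root_mono) (simp add: j_def)
    then show "(\<Sum>d=1..m. 1 / ?q (real d) ^ 3) \<le> 4 * ?q (real j)"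
      using sum_inverse_fourth_root_cubed[of m] by linarith
  qed (use qj sk in auto)
  also have "\<dots> = 2 / sqrt (real \<kappa>) * (?q (real j) ^ 4 / real j)"
    by (simp add: power4_eq_xxxx power3_eq_cube mult_ac)
  also have "?q (real j) ^ 4 / real j = 1" by (simp add: fourth_root_pow4 j_def)
  finally show ?thesis by (simp add: j_def)
qed

context
  fixes p :: "nat \<Rightarrow> real" and C :: real
  assumes p_nonneg: "\<And>j. j \<ge> 1 \<Longrightarrow> 0 \<le> p j" and p_le_1: "\<And>j. j \<ge> 1 \<Longrightarrow> p j \<le> 1"
    and p_le: "\<And>j. j \<ge> 1 \<Longrightarrow> p j \<le> C / real j" and C: "C \<ge> 1" and p1: "p 1 = 1"
begin

private lemma p01: "j \<in> {1..n} \<Longrightarrow> 0 \<le> p j \<and> p j \<le> 1"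
  using p_nonneg p_le_1 by auto

private definition loss_mgf :: "nat \<Rightarrow> nat \<Rightarrow> real" where
  "loss_mgf m l = bern_exp p {1..m} (\<lambda>A. exp (spacing_loss m l A / 4))"

private lemma loss_mgf_nonneg: "loss_mgf m l \<ge> 0"
  unfolding loss_mgf_def bern_exp_def using p01[of _ m]
  by (intro sum_nonneg mult_nonneg_nonneg prod_nonneg) auto

private lemma loss_mgf_Suc:
  "loss_mgf (Suc m) l = p (Suc m) * fourth_root (real (Suc (Suc (m + l))) / real (Suc l)) * loss_mgf m 0
     + (1 - p (Suc m)) * loss_mgf m (Suc l)"
proof -
  let ?r = "real (Suc (Suc (m + l))) / real (Suc l)"
  have "loss_mgf (Suc m) l = p (Suc m) * bern_exp p {1..m} (\<lambda>A. fourth_root ?r * exp (spacing_loss m 0 A / 4))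
     + (1 - p (Suc m)) * bern_exp p {1..m} (\<lambda>A. exp (spacing_loss m (Suc l) A / 4))"
    unfolding loss_mgf_def
  proof (rule bern_exp_atMost_Suc)
    fix A assume A: "A \<subseteq> {1..m}"
    have "spacing_loss m 0 (insert (Suc m) A) = spacing_loss m 0 A"
      by (rule spacing_loss_cong) auto
    then have "exp (spacing_loss (Suc m) l (insert (Suc m) A) / 4)
      = exp (ln ?r / 4) * exp (spacing_loss m 0 A / 4)"
      by (simp add: add_divide_distrib exp_add)
    then show "exp (spacing_loss (Suc m) l (insert (Suc m) A) / 4)
      = fourth_root ?r * exp (spacing_loss m 0 A / 4)"
      by (subst (asm) exp_ln_fourth) auto
    have "Suc m \<notin> A" using A by auto
    then show "exp (spacing_loss (Suc m) l A / 4) = exp (spacing_loss m (Suc l) A / 4)" by simp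
  qed
  then show ?thesis by (simp add: loss_mgf_def bern_exp_cmult)
qed

text \<open>Conditioning on the highest success \<open>i\<close>, below which the process starts
  afresh; the failure probabilities above \<open>i\<close> are bounded by \<open>1\<close>. Since
  \<open>p 1 = 1\<close>, such an \<open>i\<close> exists.\<close>

private lemma loss_mgf_le_sum:
  assumes "m \<ge> 1"
  shows "loss_mgf m l \<le> (\<Sum>i=1..m. p i *
     fourth_root (real (Suc (m + l)) / real (Suc (m + l) - i)) * loss_mgf (i - 1) 0)"
  using assms
proof (induction m arbitrary: l rule: dec_induct)
  case base
  show ?case using loss_mgf_Suc[of 0 l] p1 by simp
next
  case (step m)
  have "(1 - p (Suc m)) * loss_mgf m (Suc l) \<le> 1 * loss_mgf m (Suc l)"
    using p_nonneg[of "Suc m"] loss_mgf_nonneg by (intro mult_right_mono) auto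
  also have "\<dots> \<le> (\<Sum>i=1..m. p i *
     fourth_root (real (Suc (m + Suc l)) / real (Suc (m + Suc l) - i)) * loss_mgf (i - 1) 0)"
    using step.IH[of "Suc l"] by (simp only: mult_1)
  finally show ?case unfolding loss_mgf_Suc by simp
qed

text \<open>With \<open>i ^ Suc \<kappa>\<close> by induction and \<open>p i \<le> C / i\<close>,
  the sum becomes \<open>C * j ^ Suc \<kappa>\<close> times the Riemann sum of
  \<open>beta_sum_le\<close>; \<open>\<kappa> \<ge> 4 * C\<^sup>2\<close> makes
  \<open>C * 2 / sqrt \<kappa>\<close> at most \<open>1\<close>.\<close>

private lemma loss_mgf_le:
  assumes "real \<kappa> \<ge> 4 * C\<^sup>2"
  shows "loss_mgf m 0 \<le> real (Suc m) ^ Suc \<kappa>"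
proof (induction m rule: less_induct)
  case (less m)
  show ?case
  proof (cases "m = 0")
    case True
    then show ?thesis by (simp add: loss_mgf_def bern_exp_const)
  next
    case False
    have "1 \<le> C\<^sup>2" using C by simp
    then have "real \<kappa> \<ge> 1" using assms by linarith
    then have k1: "\<kappa> \<ge> 1" by linarith
    have "2 * C = sqrt (4 * C\<^sup>2)" using C by (simp add: real_sqrt_mult)
    also have "\<dots> \<le> sqrt (real \<kappa>)" using assms by simp
    finally have Ck: "2 * C \<le> sqrt (real \<kappa>)" .
    let ?j = "real (Suc m)"
    let ?q = "\<lambda>i. fourth_root (?j / real (Suc m - i))"
    have "loss_mgf m 0 \<le> (\<Sum>i=1..m. p i * ?q i * loss_mgf (i - 1) 0)"
      using loss_mgf_le_sum[of m 0] False by simp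
    also have "\<dots> \<le> (\<Sum>i=1..m. C * ?j ^ Suc \<kappa> * (1 / ?j * (real i / ?j) ^ \<kappa> * ?q i))"
    proof (rule sum_mono)
      fix i assume i: "i \<in> {1..m}"
      have q: "?q i \<ge> 0" by (intro fourth_root_nonneg) auto
      have "loss_mgf (i - 1) 0 \<le> real (Suc (i - 1)) ^ Suc \<kappa>" using i by (intro less) auto
      then have "p i * ?q i * loss_mgf (i - 1) 0 \<le> (C / real i) * ?q i * real i ^ Suc \<kappa>"
        using i q p_le[of i] p_nonneg[of i] loss_mgf_nonneg C
        by (intro mult_mono) auto
      also have "\<dots> = C * ?j ^ Suc \<kappa> * (1 / ?j * (real i / ?j) ^ \<kappa> * ?q i)"
        using i by (simp add: power_divide del: of_nat_Suc)
      finally show "p i * ?q i * loss_mgf (i - 1) 0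
          \<le> C * ?j ^ Suc \<kappa> * (1 / ?j * (real i / ?j) ^ \<kappa> * ?q i)" .
    qed
    also have "\<dots> = C * ?j ^ Suc \<kappa> * (\<Sum>i=1..m. 1 / ?j * (real i / ?j) ^ \<kappa> * ?q i)"
      by (simp only: sum_distrib_left)
    also have "\<dots> \<le> C * ?j ^ Suc \<kappa> * (2 / sqrt (real \<kappa>))"
      using beta_sum_le[OF k1] C by (intro mult_left_mono) auto
    also have "\<dots> = ?j ^ Suc \<kappa> * (2 * C / sqrt (real \<kappa>))" by simp
    also have "\<dots> \<le> ?j ^ Suc \<kappa> * 1"
      using Ck k1 by (intro mult_left_mono) (auto simp: divide_le_eq)
    finally show ?thesis by simp
  qed
qed

text \<open>Markov's inequality at level \<open>(1 + n) ^ (\<kappa> + 2)\<close>, one power above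
  the moment bound.\<close>

lemma spacing_loss_tail:
  obtains K where "K > 0" "\<And>n. bern_exp p {1..n} (\<lambda>A. of_bool (spacing_loss n 0 A > K * ln (1 + real n)))
     \<le> 1 / (1 + real n)"
proof -
  obtain \<kappa> :: nat where k: "real \<kappa> \<ge> 4 * C\<^sup>2" using real_arch_simple by blast
  have "bern_exp p {1..n} (\<lambda>A. of_bool (spacing_loss n 0 A > (4 * real (\<kappa> + 2)) * ln (1 + real n)))
     \<le> 1 / (1 + real n)" for n
  proof -
    let ?j = "1 + real n"
    have "spacing_loss n 0 A > (4 * real (\<kappa> + 2)) * ln ?j \<longleftrightarrow>
        exp (spacing_loss n 0 A / 4) > ?j ^ (\<kappa> + 2)" for A
    proof -
      have "?j ^ (\<kappa> + 2) = exp (real (\<kappa> + 2) * ln ?j)"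
        by (subst exp_of_nat_mult) (simp add: add_pos_nonneg)
      then show ?thesis by (simp only: exp_less_cancel_iff) (simp add: field_simps)
    qed
    then have "bern_exp p {1..n} (\<lambda>A. of_bool (spacing_loss n 0 A > (4 * real (\<kappa> + 2)) * ln ?j))
      = bern_exp p {1..n} (\<lambda>A. of_bool (exp (spacing_loss n 0 A / 4) > ?j ^ (\<kappa> + 2)))"
      by simp
    also have "\<dots> \<le> loss_mgf n 0 / ?j ^ (\<kappa> + 2)"
      unfolding loss_mgf_def using p01[of _ n] by (intro bern_exp_markov) (auto simp: add_pos_nonneg)
    also have "\<dots> \<le> ?j ^ Suc \<kappa> / ?j ^ (\<kappa> + 2)"
      using loss_mgf_le[OF k, of n] by (intro divide_right_mono) auto
    also have "\<dots> = 1 / ?j"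
    proof -
      have "?j ^ (\<kappa> + 2) = ?j ^ Suc \<kappa> * ?j" by simp
      moreover have "?j ^ Suc \<kappa> \<noteq> 0" by (intro power_not_zero) linarith
      ultimately show ?thesis by (metis mult.right_neutral mult_divide_mult_cancel_left)
    qed
    finally show ?thesis .
  qed
  then show ?thesis using that[of "4 * real (\<kappa> + 2)"] by simp
qed

section \<open>Coincidences of spacings\<close>

lemma sum_inverse_sqrt_cubed: "(\<Sum>i=1..m. 1 / (real i * sqrt (real i))) \<le> 3"
proof -
  \<comment> \<open>Strengthened by a bound on the remaining tail, so that the induction
    telescopes.\<close>
  have "(\<Sum>i=1..Suc m. 1 / (real i * sqrt (real i))) \<le> 3 - 2 / sqrt (real (Suc m))" for m
  proof (induction m)
    case 0 show ?case by simp
  next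
    case (Suc m)
    define x y where "x = sqrt (real (Suc m))" and "y = sqrt (real (Suc (Suc m)))"
    have xy: "0 < x" "x \<le> y" unfolding x_def y_def by auto
    have "1 = y\<^sup>2 - x\<^sup>2" unfolding x_def y_def by simp
    also have "\<dots> = (y - x) * (y + x)" by (simp add: power2_eq_square algebra_simps)
    also have "\<dots> \<le> (y - x) * (2 * y)" using xy by (intro mult_left_mono) auto
    finally have h: "1 \<le> 2 * (y - x) * y" by (simp add: algebra_simps)
    have "1 / (y * y * y) \<le> (2 * (y - x) * y) / (y * y * y)"
      using h xy by (intro divide_right_mono) auto
    also have "\<dots> = 2 * (y - x) / (y * y)" using xy by simp
    also have "\<dots> \<le> 2 * (y - x) / (x * y)" using xy by (intro divide_left_mono mult_right_mono) auto
    also have "\<dots> = 2 / x - 2 / y" using xy by (simp add: field_simps)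
    finally have "1 / (y * y * y) \<le> 2 / x - 2 / y" .
    moreover have "real (Suc (Suc m)) = y * y" unfolding y_def by simp
    ultimately have "1 / (real (Suc (Suc m)) * sqrt (real (Suc (Suc m)))) \<le> 2 / x - 2 / y"
      unfolding y_def by simp
    then show ?case using Suc unfolding x_def y_def by simp
  qed
  moreover have "0 \<le> 2 / sqrt (real (Suc m))" for m by simp
  ultimately have "(\<Sum>i=1..Suc m. 1 / (real i * sqrt (real i))) \<le> 3" for m
    by (smt (verit, best))
  then show ?thesis by (cases m) auto
qed

text \<open>The estimate \<open>sqrt i * sqrt k \<le> i + k\<close> splits the decay: the power
  \<open>3 / 2\<close> of \<open>i\<close> is summable, and \<open>1 / sqrt k\<close> is left
  over.\<close>

private lemma sum_pair_prob_le:
  assumes "k \<ge> 1" "I \<subseteq> {1..n}"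
  shows "(\<Sum>i\<in>I. p i * p (i + k)) \<le> 3 * C\<^sup>2 / sqrt (real k)"
proof -
  have sk: "sqrt (real k) > 0" using assms by simp
  have "(\<Sum>i\<in>I. p i * p (i + k)) \<le> (\<Sum>i\<in>{1..n}. p i * p (i + k))"
    using assms p_nonneg by (intro sum_mono2) auto
  also have "\<dots> \<le> (\<Sum>i\<in>{1..n}. C\<^sup>2 / sqrt (real k) * (1 / (real i * sqrt (real i))))"
  proof (rule sum_mono)
    fix i assume i: "i \<in> {1..n}"
    have "sqrt (real i) * sqrt (real k) \<le> real (i + k)"
    proof -
      have "0 \<le> (sqrt (real i) - sqrt (real k))\<^sup>2" by simp
      then have "2 * (sqrt (real i) * sqrt (real k)) \<le> real (i + k)" by (simp add: power2_diff)
      moreover have "0 \<le> sqrt (real i) * sqrt (real k)" by simp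
      ultimately show ?thesis by linarith
    qed
    then have "C / real (i + k) \<le> C / (sqrt (real i) * sqrt (real k))"
      using C i assms by (intro divide_left_mono) auto
    then have "p (i + k) \<le> C / (sqrt (real i) * sqrt (real k))"
      using p_le[of "i + k"] i by simp
    then have "p i * p (i + k) \<le> (C / real i) * (C / (sqrt (real i) * sqrt (real k)))"
      using p_le[of i] p_nonneg[of i] p_nonneg[of "i + k"] C i by (intro mult_mono) auto
    also have "\<dots> = C\<^sup>2 / sqrt (real k) * (1 / (real i * sqrt (real i)))"
      by (simp add: power2_eq_square)
    finally show "p i * p (i + k) \<le> C\<^sup>2 / sqrt (real k) * (1 / (real i * sqrt (real i)))" .
  qed
  also have "\<dots> = C\<^sup>2 / sqrt (real k) * (\<Sum>i=1..n. 1 / (real i * sqrt (real i)))"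
    by (simp only: sum_distrib_left)
  also have "\<dots> \<le> C\<^sup>2 / sqrt (real k) * 3"
    using sum_inverse_sqrt_cubed sk by (intro mult_left_mono) auto
  finally show ?thesis by (simp add: mult.commute)
qed

private lemma pair_prob_le:
  assumes "finite B" "{i, i + k} \<subseteq> B" "\<And>j. j \<in> B \<Longrightarrow> j \<ge> 1" "k \<ge> 1"
  shows "(\<Prod>j\<in>B. p j) \<le> p i * p (i + k)"
proof -
  have "(\<Prod>j\<in>B. p j) = (\<Prod>j\<in>B - {i, i + k}. p j) * (\<Prod>j\<in>{i, i + k}. p j)"
    using assms by (intro prod.subset_diff) auto
  also have "\<dots> \<le> 1 * (\<Prod>j\<in>{i, i + k}. p j)"
  proof (rule mult_right_mono)
    show "(\<Prod>j\<in>B - {i, i + k}. p j) \<le> 1"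
      using assms(3) p_nonneg p_le_1 by (intro prod_le_1) auto
    show "0 \<le> (\<Prod>j\<in>{i, i + k}. p j)"
      using assms p_nonneg by (intro prod_nonneg) auto
  qed
  also have "\<dots> = p i * p (i + k)" using assms(4) by simp
  finally show ?thesis .
qed

text \<open>The square is a double sum over pairs. Disjoint pairs are independent; overlaps occur
  only for \<open>i' = i\<close>, \<open>i' = i + k\<close> or \<open>i = i' + k\<close> and are
  bounded by one pair alone, which gives \<open>3 * sum Q I\<close>. The final \<open>18\<close> is
  \<open>9 + 9\<close>, after weakening \<open>k\<close> to \<open>sqrt k\<close> and
  \<open>C\<^sup>2\<close> to \<open>C ^ 4\<close>.\<close>

private lemma pair_count_second_moment:
  assumes "k \<ge> 1"
  shows "bern_exp p {1..n} (\<lambda>A. (real (pair_count n k A))\<^sup>2) \<le> 18 * C ^ 4 / sqrt (real k)"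
proof -
  define I where "I = {i\<in>{1..n}. i + k \<le> n}"
  have I: "finite I" "I \<subseteq> {1..n}" by (auto simp: I_def)
  define Q where "Q = (\<lambda>i. p i * p (i + k))"
  have Q0: "Q i \<ge> 0" if "i \<in> I" for i using that p_nonneg by (auto simp: Q_def I_def)
  have sq: "(real (pair_count n k A))\<^sup>2 =
     (\<Sum>i\<in>I. \<Sum>i'\<in>I. of_bool ({i, i + k, i', i' + k} \<subseteq> A))" for A
  proof -
    have "real (pair_count n k A) = (\<Sum>i\<in>I. of_bool ({i, i + k} \<subseteq> A))"
    proof -
      have "{i\<in>{1..n}. i + k \<le> n \<and> {i, i + k} \<subseteq> A} = I \<inter> {i. {i, i + k} \<subseteq> A}"
        by (auto simp: I_def)
      then show ?thesis unfolding pair_count_def using I(1) by (simp add: sum_of_bool_eq)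
    qed
    then show ?thesis
      by (simp add: power2_eq_square sum_product of_bool_conj[symmetric] conj_assoc)
  qed
  have pairwise: "bern_exp p {1..n} (\<lambda>A. of_bool ({i, i + k, i', i' + k} \<subseteq> A))
      \<le> Q i * Q i' + Q i * of_bool (i' = i) + Q i * of_bool (i' = i + k) + Q i' * of_bool (i = i' + k)"
    if "i \<in> I" "i' \<in> I" for i i'
  proof -
    let ?B = "{i, i + k, i', i' + k}"
    have BI: "?B \<subseteq> {1..n}" using that by (auto simp: I_def)
    have E: "bern_exp p {1..n} (\<lambda>A. of_bool (?B \<subseteq> A)) = (\<Prod>j\<in>?B. p j)"
      using p01[of _ n] BI by (intro bern_exp_subset) auto
    have Qi: "(\<Prod>j\<in>?B. p j) \<le> Q i" unfolding Q_def using BI assms by (intro pair_prob_le) auto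
    have Qi': "(\<Prod>j\<in>?B. p j) \<le> Q i'" unfolding Q_def using BI assms by (intro pair_prob_le) auto
    have nn: "0 \<le> Q i * Q i'" "0 \<le> Q i" "0 \<le> Q i'" using Q0 that by auto
    show ?thesis
    proof (cases "i' = i \<or> i' = i + k \<or> i = i' + k")
      case True
      have ge0: "0 \<le> Q i * of_bool P" "0 \<le> Q i' * of_bool P" for P using nn by auto
      consider "Q i * of_bool (i' = i) = Q i" | "Q i * of_bool (i' = i + k) = Q i"
        | "Q i' * of_bool (i = i' + k) = Q i'"
        using True by (metis of_bool_eq(2) mult.right_neutral)
      then show ?thesis unfolding E
        using Qi Qi' nn ge0(1)[of "i' = i"] ge0(1)[of "i' = i + k"] ge0(2)[of "i = i' + k"]
        by cases linarith+
    next
      case False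
      then have "(\<Prod>j\<in>?B. p j) = Q i * Q i'" unfolding Q_def using assms by auto
      then show ?thesis unfolding E using nn by simp
    qed
  qed
  have S: "sum Q I \<le> 3 * C\<^sup>2 / sqrt (real k)" "0 \<le> sum Q I"
    unfolding Q_def using sum_pair_prob_le[OF assms I(2)] Q0
    by (auto intro!: sum_nonneg simp: Q_def)
  have "bern_exp p {1..n} (\<lambda>A. (real (pair_count n k A))\<^sup>2)
     \<le> (\<Sum>i\<in>I. \<Sum>i'\<in>I. Q i * Q i' + Q i * of_bool (i' = i) + Q i * of_bool (i' = i + k) + Q i' * of_bool (i = i' + k))"
    unfolding sq bern_exp_sum by (intro sum_mono pairwise)
  also have "\<dots> = (sum Q I)\<^sup>2 + (\<Sum>i\<in>I. Q i * (\<Sum>i'\<in>I. of_bool (i' = i)))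
      + (\<Sum>i\<in>I. Q i * (\<Sum>i'\<in>I. of_bool (i' = i + k))) + (\<Sum>i'\<in>I. Q i' * (\<Sum>i\<in>I. of_bool (i = i' + k)))"
  proof -
    have "(sum Q I)\<^sup>2 = (\<Sum>i\<in>I. \<Sum>i'\<in>I. Q i * Q i')"
      by (simp only: power2_eq_square sum_product)
    moreover have "(\<Sum>i\<in>I. \<Sum>i'\<in>I. Q i' * of_bool (i = i' + k))
        = (\<Sum>i'\<in>I. \<Sum>i\<in>I. Q i' * of_bool (i = i' + k))"
      by (rule sum.swap)
    ultimately show ?thesis by (simp only: sum.distrib sum_distrib_left)
  qed
  also have "\<dots> \<le> (sum Q I)\<^sup>2 + (\<Sum>i\<in>I. Q i * 1) + (\<Sum>i\<in>I. Q i * 1) + (\<Sum>i\<in>I. Q i * 1)"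
  proof -
    have "(\<Sum>i'\<in>I. of_bool (i' = x)) \<le> (1::real)" for x
    proof -
      have "(\<Sum>i'\<in>I. of_bool (i' = x)) = (if x \<in> I then 1 else (0::real))"
        using I(1) by (simp add: of_bool_def)
      then show ?thesis by simp
    qed
    then show ?thesis using Q0 by (intro add_mono sum_mono mult_left_mono order_refl) auto
  qed
  also have "\<dots> = (sum Q I)\<^sup>2 + 3 * sum Q I" by simp
  also have "\<dots> \<le> (3 * C\<^sup>2 / sqrt (real k))\<^sup>2 + 3 * (3 * C\<^sup>2 / sqrt (real k))"
    using S by (intro add_mono power_mono mult_left_mono) auto
  also have "\<dots> = 9 * C ^ 4 / real k + 9 * C\<^sup>2 / sqrt (real k)"
    by (simp add: power_divide power_mult_distrib)
  also have "\<dots> \<le> 9 * C ^ 4 / sqrt (real k) + 9 * C ^ 4 / sqrt (real k)"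
  proof (intro add_mono)
    have "sqrt (real k) \<le> real k"
      using assms by (intro real_le_lsqrt) (auto simp: power2_eq_square)
    then show "9 * C ^ 4 / real k \<le> 9 * C ^ 4 / sqrt (real k)"
      using assms C by (intro divide_left_mono) auto
    have "C\<^sup>2 \<le> C ^ 4" using C by (intro power_increasing) auto
    then show "9 * C\<^sup>2 / sqrt (real k) \<le> 9 * C ^ 4 / sqrt (real k)"
      by (intro divide_right_mono) auto
  qed
  finally show ?thesis by simp
qed

text \<open>The weight \<open>1 / (2 * k)\<close> times the moment's \<open>1 / sqrt k\<close> is
  summable, so the bound is free of \<open>n\<close>.\<close>

lemma pair_excess_expectation: "bern_exp p {1..n} (pair_excess n) \<le> 27 * C ^ 4"
proof -
  have "bern_exp p {1..n} (pair_excess n) =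
     (\<Sum>k=1..n. (1 / (2 * real k)) * bern_exp p {1..n} (\<lambda>A. (real (pair_count n k A))\<^sup>2))"
    unfolding pair_excess_def[abs_def] bern_exp_sum by (simp add: bern_exp_cmult[symmetric])
  also have "\<dots> \<le> (\<Sum>k=1..n. (1 / (2 * real k)) * (18 * C ^ 4 / sqrt (real k)))"
    using pair_count_second_moment by (intro sum_mono mult_left_mono) auto
  also have "\<dots> = 9 * C ^ 4 * (\<Sum>k=1..n. 1 / (real k * sqrt (real k)))"
    unfolding sum_distrib_left by (intro sum.cong refl) simp
  also have "\<dots> \<le> 9 * C ^ 4 * 3" using sum_inverse_sqrt_cubed C by (intro mult_left_mono) auto
  finally show ?thesis by simp
qed

lemma pair_excess_tail:
  assumes "c > 0"
  shows "bern_exp p {1..n} (\<lambda>A. of_bool (pair_excess n A > c)) \<le> 27 * C ^ 4 / c"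
proof -
  have "bern_exp p {1..n} (\<lambda>A. of_bool (pair_excess n A > c)) \<le> bern_exp p {1..n} (pair_excess n) / c"
    using p01[of _ n] assms by (intro bern_exp_markov) (auto simp: pair_excess_def intro!: sum_nonneg)
  also have "\<dots> \<le> 27 * C ^ 4 / c"
    using pair_excess_expectation assms by (intro divide_right_mono) auto
  finally show ?thesis .
qed

end

subsection \<open>Mean and variance\<close>

lemma ln_Suc_increment:
  assumes "n \<ge> 1"
  shows "1 / real (Suc n) \<le> ln (real (Suc n)) - ln (real n)"
    "ln (real (Suc n)) - ln (real n) \<le> 1 / real n"
proof -
  have "ln (real n / real (Suc n)) \<le> real n / real (Suc n) - 1"
    using assms by (intro ln_le_minus_one) auto
  then show "1 / real (Suc n) \<le> ln (real (Suc n)) - ln (real n)"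
    using assms by (simp add: ln_div field_simps)
  have "ln (real (Suc n) / real n) \<le> real (Suc n) / real n - 1"
    using assms by (intro ln_le_minus_one) auto
  then show "ln (real (Suc n)) - ln (real n) \<le> 1 / real n"
    using assms by (simp add: ln_div field_simps)
qed

lemma sum_inverse_le_ln: "n \<ge> 1 \<Longrightarrow> (\<Sum>j=1..n. 1 / real j) \<le> 1 + ln (real n)"
proof (induction n rule: dec_induct)
  case base show ?case by simp
next
  case (step n)
  then show ?case using ln_Suc_increment(1)[of n] by simp
qed

context
  fixes n :: nat and b \<epsilon> :: real
  assumes n: "n \<ge> 1"
  defines "b \<equiv> ln (real (Suc n))" and "\<epsilon> \<equiv> ln (real (Suc n)) - ln (real n)"
begin

private lemma eps: "0 \<le> \<epsilon>" "\<epsilon> \<le> 1 / real n" "\<bar>1 / real (Suc n) - \<epsilon>\<bar> \<le> 1 / (real n * real (Suc n))"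
proof -
  note e = ln_Suc_increment[OF n, folded \<epsilon>_def]
  show "\<epsilon> \<le> 1 / real n" by (rule e)
  have "0 \<le> 1 / real (Suc n)" by simp
  then show "0 \<le> \<epsilon>" using e(1) by linarith
  have "1 / real n - 1 / real (Suc n) = 1 / (real n * real (Suc n))"
    using n by (simp add: field_simps)
  then show "\<bar>1 / real (Suc n) - \<epsilon>\<bar> \<le> 1 / (real n * real (Suc n))" using e by linarith
qed

private lemma b_bounds: "0 \<le> b" "b \<le> real n"
  using ln_le_minus_one[of "real (Suc n)"] by (auto simp: b_def)

private lemma eps_square: "\<epsilon>\<^sup>2 \<le> 2 / real (Suc n)"
proof -
  have "\<epsilon>\<^sup>2 \<le> (1 / real n)\<^sup>2" using eps by (intro power_mono) auto
  also have "\<dots> \<le> 2 / real (Suc n)"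
  proof -
    have "real (Suc n) \<le> 2 * real n" using n by simp
    also have "\<dots> \<le> 2 * (real n)\<^sup>2" using n by (simp add: power2_eq_square)
    finally show ?thesis using n by (simp add: power_divide field_simps)
  qed
  finally show ?thesis .
qed

text \<open>One cell of comparing a sum with the integral of \<open>ln t / t\<close>. In the error,
  \<open>1 / Suc n - \<epsilon>\<close> is of order \<open>1 / n\<^sup>2\<close>, so even the crude
  \<open>b \<le> n\<close> leaves \<open>1 / Suc n\<close>.\<close>

lemma ln_square_step:
  "\<bar>ln (real (Suc n)) / real (Suc n) - ((ln (real (Suc n)))\<^sup>2 / 2 - (ln (real n))\<^sup>2 / 2)\<bar> \<le> 2 / real (Suc n)"
proof -
  have a: "ln (real n) = b - \<epsilon>" by (simp add: b_def \<epsilon>_def)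
  have eq: "b / real (Suc n) - (b\<^sup>2 / 2 - (b - \<epsilon>)\<^sup>2 / 2) = b * (1 / real (Suc n) - \<epsilon>) + \<epsilon>\<^sup>2 / 2"
    by (simp add: power2_eq_square field_simps)
  have "\<bar>b * (1 / real (Suc n) - \<epsilon>)\<bar> \<le> real n * (1 / (real n * real (Suc n)))"
    unfolding abs_mult using b_bounds eps by (intro mult_mono) auto
  also have "\<dots> = 1 / real (Suc n)" using n by simp
  finally have 1: "\<bar>b * (1 / real (Suc n) - \<epsilon>)\<bar> \<le> 1 / real (Suc n)" .
  have 2: "0 \<le> \<epsilon>\<^sup>2 / 2" "\<epsilon>\<^sup>2 / 2 \<le> 1 / real (Suc n)" using eps_square by auto
  have "2 / real (Suc n) = 1 / real (Suc n) + 1 / real (Suc n)" by simp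
  then show ?thesis unfolding a b_def[symmetric] eq using 1 2 by linarith
qed

text \<open>The same for \<open>(ln t)\<^sup>2 / t\<close>. Only one of the two factors
  \<open>b\<close> is bounded by \<open>n\<close>; the other survives as the logarithm in the
  bound.\<close>

lemma ln_cube_step:
  "\<bar>(ln (real (Suc n)))\<^sup>2 / real (Suc n) - ((ln (real (Suc n)))^3 / 3 - (ln (real n))^3 / 3)\<bar>
     \<le> (3 * ln (real (Suc n)) + 1) / real (Suc n)"
proof -
  have a: "ln (real n) = b - \<epsilon>" by (simp add: b_def \<epsilon>_def)
  have eq: "b\<^sup>2 / real (Suc n) - (b^3 / 3 - (b - \<epsilon>)^3 / 3)
      = b * (b * (1 / real (Suc n) - \<epsilon>)) + \<epsilon>\<^sup>2 * b - \<epsilon>\<^sup>2 * (\<epsilon> / 3)"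
    by (simp add: power2_eq_square power3_eq_cube field_simps)
  have "\<bar>b * (1 / real (Suc n) - \<epsilon>)\<bar> \<le> real n * (1 / (real n * real (Suc n)))"
    unfolding abs_mult using b_bounds eps by (intro mult_mono) auto
  also have "\<dots> = 1 / real (Suc n)" using n by simp
  finally have "\<bar>b * (b * (1 / real (Suc n) - \<epsilon>))\<bar> \<le> b * (1 / real (Suc n))"
    unfolding abs_mult[of b "b * _"] using b_bounds by (intro mult_mono) auto
  then have 1: "\<bar>b * (b * (1 / real (Suc n) - \<epsilon>))\<bar> \<le> b / real (Suc n)" by simp
  have "\<epsilon>\<^sup>2 * b \<le> 2 / real (Suc n) * b" using eps_square b_bounds by (intro mult_right_mono) auto
  then have 2: "0 \<le> \<epsilon>\<^sup>2 * b" "\<epsilon>\<^sup>2 * b \<le> 2 * b / real (Suc n)" using b_bounds by auto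
  have "1 / real n \<le> 1" using n by simp
  then have "\<epsilon> / 3 \<le> 1 / 2" using eps by linarith
  then have "\<epsilon>\<^sup>2 * (\<epsilon> / 3) \<le> 2 / real (Suc n) * (1 / 2)" using eps eps_square by (intro mult_mono) auto
  also have "\<dots> = 1 / real (Suc n)" by (simp add: divide_simps)
  finally have "\<epsilon>\<^sup>2 * (\<epsilon> / 3) \<le> 1 / real (Suc n)" .
  moreover have "0 \<le> \<epsilon>\<^sup>2 * (\<epsilon> / 3)" using eps by simp
  ultimately have 3: "0 \<le> \<epsilon>\<^sup>2 * (\<epsilon> / 3)" "\<epsilon>\<^sup>2 * (\<epsilon> / 3) \<le> 1 / real (Suc n)" by simp_all
  have "(3 * b + 1) / real (Suc n) = b / real (Suc n) + 2 * b / real (Suc n) + 1 / real (Suc n)"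
    unfolding add_divide_distrib[symmetric] by simp
  then show ?thesis unfolding a b_def[symmetric] eq using 1 2 3 by linarith
qed

end

lemma sum_ln_over:
  assumes "n \<ge> 1"
  shows "\<bar>(\<Sum>j=1..n. ln (real j) / real j) - (ln (real n))\<^sup>2 / 2\<bar> \<le> 2 * (1 + ln (real n))"
proof -
  have "\<bar>(\<Sum>j=1..n. ln (real j) / real j) - (ln (real n))\<^sup>2 / 2\<bar> \<le> (\<Sum>j=1..n. 2 / real j)"
    using assms
  proof (induction n rule: dec_induct)
    case base show ?case by simp
  next
    case (step n)
    have "(\<Sum>j=1..Suc n. ln (real j) / real j) - (ln (real (Suc n)))\<^sup>2 / 2
       = ((\<Sum>j=1..n. ln (real j) / real j) - (ln (real n))\<^sup>2 / 2)
        + (ln (real (Suc n)) / real (Suc n) - ((ln (real (Suc n)))\<^sup>2 / 2 - (ln (real n))\<^sup>2 / 2))"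
      by simp
    moreover have "(\<Sum>j=1..Suc n. 2 / real j) = (\<Sum>j=1..n. 2 / real j) + 2 / real (Suc n)" by simp
    ultimately show ?case using step.IH ln_square_step[OF step.hyps(1)] by linarith
  qed
  also have "\<dots> = 2 * (\<Sum>j=1..n. 1 / real j)" by (simp add: sum_distrib_left)
  also have "\<dots> \<le> 2 * (1 + ln (real n))"
    using sum_inverse_le_ln[OF assms] by (intro mult_left_mono) auto
  finally show ?thesis .
qed

lemma sum_mult_inverse_le:
  assumes "n \<ge> 1" "\<And>j. 1 \<le> j \<Longrightarrow> j \<le> n \<Longrightarrow> f j \<le> M / real j" "M \<ge> 0"
  shows "(\<Sum>j=1..n. f j) \<le> M * (1 + ln (real n))"
proof -
  have "(\<Sum>j=1..n. f j) \<le> (\<Sum>j=1..n. M * (1 / real j))" using assms by (intro sum_mono) auto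
  also have "\<dots> = M * (\<Sum>j=1..n. 1 / real j)" by (simp only: sum_distrib_left)
  also have "\<dots> \<le> M * (1 + ln (real n))"
    using sum_inverse_le_ln[OF assms(1)] assms(3) by (intro mult_left_mono)
  finally show ?thesis .
qed

lemma sum_ln_square_over:
  assumes "n \<ge> 1"
  shows "\<bar>(\<Sum>j=1..n. (ln (real j))\<^sup>2 / real j) - (ln (real n))^3 / 3\<bar> \<le> 3 * (1 + ln (real n))\<^sup>2"
proof -
  have "\<bar>(\<Sum>j=1..n. (ln (real j))\<^sup>2 / real j) - (ln (real n))^3 / 3\<bar>
      \<le> (\<Sum>j=1..n. (3 * ln (real j) + 1) / real j)"
    using assms
  proof (induction n rule: dec_induct)
    case base show ?case by simp
  next
    case (step n)
    have "(\<Sum>j=1..Suc n. (ln (real j))\<^sup>2 / real j) - (ln (real (Suc n)))^3 / 3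
       = ((\<Sum>j=1..n. (ln (real j))\<^sup>2 / real j) - (ln (real n))^3 / 3)
        + ((ln (real (Suc n)))\<^sup>2 / real (Suc n) - ((ln (real (Suc n)))^3 / 3 - (ln (real n))^3 / 3))"
      by simp
    moreover have "(\<Sum>j=1..Suc n. (3 * ln (real j) + 1) / real j)
      = (\<Sum>j=1..n. (3 * ln (real j) + 1) / real j) + (3 * ln (real (Suc n)) + 1) / real (Suc n)" by simp
    ultimately show ?case using step.IH ln_cube_step[OF step.hyps(1)] by linarith
  qed
  also have "\<dots> \<le> (3 * ln (real n) + 1) * (1 + ln (real n))"
    using assms by (intro sum_mult_inverse_le divide_right_mono) auto
  also have "\<dots> \<le> (3 * (1 + ln (real n))) * (1 + ln (real n))"
    using assms by (intro mult_right_mono) auto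
  also have "\<dots> = 3 * (1 + ln (real n))\<^sup>2" by (simp add: power2_eq_square)
  finally show ?thesis .
qed

context
  fixes \<theta> C B :: real
  assumes \<theta>: "\<theta> > 0"
  defines "C \<equiv> max 1 \<theta>" and "B \<equiv> C * (1 + \<theta>)"
begin

private lemma CB: "C \<ge> 1" "B \<ge> 0" using \<theta> by (auto simp: C_def B_def)

private lemma feller_prob_le: "j \<ge> 1 \<Longrightarrow> feller_prob \<theta> j \<le> C / real j"
  unfolding C_def by (rule feller_prob_bounds[OF \<theta>])

text \<open>The difference is \<open>feller_prob \<theta> j * ((1 - \<theta>) / j)\<close>; bounding
  the factors by \<open>C / j\<close> and \<open>(1 + \<theta>) / j\<close> yields
  \<open>B\<close>.\<close>

private lemma feller_prob_approx:
  assumes "j \<ge> 1" shows "\<bar>feller_prob \<theta> j - \<theta> / real j\<bar> \<le> B / (real j)\<^sup>2"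
proof -
  have j: "real j \<ge> 1" using assms by simp
  have pos: "\<theta> + real j - 1 > 0" using \<theta> j by linarith
  have "feller_prob \<theta> j - \<theta> / real j = feller_prob \<theta> j * ((1 - \<theta>) / real j)"
    unfolding feller_prob_def using pos j by (simp add: field_simps)
  then have "\<bar>feller_prob \<theta> j - \<theta> / real j\<bar> = feller_prob \<theta> j * (\<bar>1 - \<theta>\<bar> / real j)"
    using feller_prob_bounds(1)[OF \<theta> assms] by (simp add: abs_mult)
  also have "\<dots> \<le> C / real j * ((1 + \<theta>) / real j)"
    using feller_prob_le[OF assms] feller_prob_bounds(1)[OF \<theta> assms] CB \<theta>
    by (intro mult_mono divide_right_mono) auto
  finally show ?thesis by (simp add: B_def power2_eq_square)
qed

text \<open>The error \<open>B / j\<^sup>2\<close>, even times \<open>ln j \<le> j\<close>, sums to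
  a logarithm, so centring at the leading term stays within the tolerated error.\<close>

lemma feller_mean:
  assumes "n \<ge> 1"
  shows "\<bar>(\<Sum>j=1..n. feller_prob \<theta> j * ln (real j)) - \<theta> / 2 * (ln (real n))\<^sup>2\<bar>
     \<le> (B + 2 * \<theta>) * (1 + ln (real n))"
proof -
  let ?L = "ln (real n)"
  have "(\<Sum>j=1..n. feller_prob \<theta> j * ln (real j)) - \<theta> * (\<Sum>j=1..n. ln (real j) / real j)
      = (\<Sum>j=1..n. (feller_prob \<theta> j - \<theta> / real j) * ln (real j))"
    by (simp add: sum_distrib_left sum_subtractf[symmetric] left_diff_distrib)
  also have "\<bar>\<dots>\<bar> \<le> (\<Sum>j=1..n. \<bar>(feller_prob \<theta> j - \<theta> / real j) * ln (real j)\<bar>)"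
    by (rule sum_abs)
  also have "\<dots> \<le> B * (1 + ?L)"
  proof (rule sum_mult_inverse_le[OF assms _ CB(2)])
    fix j :: nat assume j: "1 \<le> j" "j \<le> n"
    have "\<bar>(feller_prob \<theta> j - \<theta> / real j) * ln (real j)\<bar> \<le> B / (real j)\<^sup>2 * real j"
      unfolding abs_mult using feller_prob_approx[OF j(1)] j ln_le_minus_one[of "real j"] CB
      by (intro mult_mono) auto
    then show "\<bar>(feller_prob \<theta> j - \<theta> / real j) * ln (real j)\<bar> \<le> B / real j"
      using j by (simp add: power2_eq_square)
  qed
  finally have 1: "\<bar>(\<Sum>j=1..n. feller_prob \<theta> j * ln (real j)) - \<theta> * (\<Sum>j=1..n. ln (real j) / real j)\<bar>
     \<le> B * (1 + ?L)" .
  have "\<bar>\<theta> * (\<Sum>j=1..n. ln (real j) / real j) - \<theta> * (?L\<^sup>2 / 2)\<bar> \<le> \<theta> * (2 * (1 + ?L))"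
    unfolding right_diff_distrib[symmetric] abs_mult
    using sum_ln_over[OF assms] \<theta> by (intro mult_mono) auto
  moreover have "\<theta> * (?L\<^sup>2 / 2) = \<theta> / 2 * ?L\<^sup>2" "(B + 2 * \<theta>) * (1 + ?L) = B * (1 + ?L) + \<theta> * (2 * (1 + ?L))"
    by (simp_all add: algebra_simps)
  ultimately show ?thesis using 1 by linarith
qed

text \<open>One factor \<open>ln j\<close> is bounded by \<open>j\<close>, the other by
  \<open>ln n\<close>. Relative to the variance the error is \<open>O (1 / ln n)\<close>, and it
  enters the normal approximation linearly.\<close>

lemma feller_variance:
  assumes "n \<ge> 1"
  shows "\<bar>(\<Sum>j=1..n. feller_prob \<theta> j * (1 - feller_prob \<theta> j) * (ln (real j))\<^sup>2) - \<theta> / 3 * (ln (real n))^3\<bar>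
     \<le> (B + C\<^sup>2 + 3 * \<theta>) * (1 + ln (real n))\<^sup>2"
proof -
  let ?L = "ln (real n)" and ?p = "feller_prob \<theta>"
  have L: "?L \<ge> 0" using assms by simp
  have "(\<Sum>j=1..n. ?p j * (1 - ?p j) * (ln (real j))\<^sup>2) - \<theta> * (\<Sum>j=1..n. (ln (real j))\<^sup>2 / real j)
      = (\<Sum>j=1..n. (?p j - \<theta> / real j - (?p j)\<^sup>2) * (ln (real j))\<^sup>2)"
    by (simp add: sum_distrib_left sum_subtractf[symmetric] algebra_simps power2_eq_square)
  also have "\<bar>\<dots>\<bar> \<le> (\<Sum>j=1..n. \<bar>(?p j - \<theta> / real j - (?p j)\<^sup>2) * (ln (real j))\<^sup>2\<bar>)"
    by (rule sum_abs)
  also have "\<dots> \<le> ((B + C\<^sup>2) * ?L) * (1 + ?L)"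
  proof (rule sum_mult_inverse_le[OF assms])
    fix j :: nat assume j: "1 \<le> j" "j \<le> n"
    have "(?p j)\<^sup>2 \<le> (C / real j)\<^sup>2"
      using feller_prob_le[OF j(1)] feller_prob_bounds(1)[OF \<theta> j(1)] by (intro power_mono) auto
    then have "\<bar>?p j - \<theta> / real j - (?p j)\<^sup>2\<bar> \<le> B / (real j)\<^sup>2 + C\<^sup>2 / (real j)\<^sup>2"
      using feller_prob_approx[OF j(1)] zero_le_power2[of "?p j"] unfolding power_divide by linarith
    also have "\<dots> = (B + C\<^sup>2) / (real j)\<^sup>2" by (simp add: add_divide_distrib)
    finally have 1: "\<bar>?p j - \<theta> / real j - (?p j)\<^sup>2\<bar> \<le> (B + C\<^sup>2) / (real j)\<^sup>2" .
    have 2: "(ln (real j))\<^sup>2 \<le> ?L * real j"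
      unfolding power2_eq_square using j ln_le_minus_one[of "real j"] by (intro mult_mono) auto
    have "\<bar>(?p j - \<theta> / real j - (?p j)\<^sup>2) * (ln (real j))\<^sup>2\<bar> \<le> (B + C\<^sup>2) / (real j)\<^sup>2 * (?L * real j)"
      unfolding abs_mult using 1 2 CB by (intro mult_mono) auto
    also have "\<dots> = (B + C\<^sup>2) * ?L / real j" using j by (simp add: power2_eq_square)
    finally show "\<bar>(?p j - \<theta> / real j - (?p j)\<^sup>2) * (ln (real j))\<^sup>2\<bar> \<le> (B + C\<^sup>2) * ?L / real j" .
  qed (use CB L in auto)
  also have "\<dots> \<le> ((B + C\<^sup>2) * (1 + ?L)) * (1 + ?L)"
    using CB L by (intro mult_right_mono mult_left_mono) auto
  finally have 1: "\<bar>(\<Sum>j=1..n. ?p j * (1 - ?p j) * (ln (real j))\<^sup>2) - \<theta> * (\<Sum>j=1..n. (ln (real j))\<^sup>2 / real j)\<bar>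
     \<le> (B + C\<^sup>2) * (1 + ?L)\<^sup>2" by (simp add: power2_eq_square)
  have "\<bar>\<theta> * (\<Sum>j=1..n. (ln (real j))\<^sup>2 / real j) - \<theta> * (?L^3 / 3)\<bar> \<le> \<theta> * (3 * (1 + ?L)\<^sup>2)"
    unfolding right_diff_distrib[symmetric] abs_mult
    using sum_ln_square_over[OF assms] \<theta> by (intro mult_mono) auto
  moreover have "\<theta> * (?L^3 / 3) = \<theta> / 3 * ?L^3"
    "(B + C\<^sup>2 + 3 * \<theta>) * (1 + ?L)\<^sup>2 = (B + C\<^sup>2) * (1 + ?L)\<^sup>2 + \<theta> * (3 * (1 + ?L)\<^sup>2)"
    by (simp_all add: algebra_simps)
  ultimately show ?thesis using 1 by linarith
qed

text \<open>\<open>K\<close> is chosen before \<open>n\<close> and \<open>x\<close>, the uniformity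
  that the supremum needs. \<open>L0\<close> forces \<open>n \<ge> 2\<close> and a variance defect
  of at most \<open>1 / 2\<close>.\<close>

lemma ewens_invol_berry_esseen:
  "\<exists>L0\<ge>1. \<exists>K. \<forall>n x. ln (real n) \<ge> L0 \<longrightarrow>
     \<bar>ewens_prob \<theta> n
        (\<lambda>\<sigma>. (ln (invol n (cycle_count n \<sigma>)) - \<theta> / 2 * (ln (real n))\<^sup>2) / sqrt (\<theta> / 3 * (ln (real n))^3) \<le> x)
      - Phi x\<bar> \<le> K / sqrt (ln (real n))"
proof -
  let ?p = "feller_prob \<theta>"
  have p1: "?p 1 = 1" using \<theta> by (simp add: feller_prob_def)
  note pb = feller_prob_bounds(1,2)[OF \<theta>]
  have p01: "j \<in> {1..n} \<Longrightarrow> 0 \<le> ?p j \<and> ?p j \<le> 1" for j n using pb by auto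
  obtain D where D: "D > 0" "\<And>n. bern_exp ?p {1..n} (\<lambda>A. of_bool (spacing_loss n 0 A > D * ln (1 + real n)))
     \<le> 1 / (1 + real n)"
    using spacing_loss_tail[of ?p C] pb feller_prob_le CB p1 by blast
  have pair_tail: "bern_exp ?p {1..n} (\<lambda>A. of_bool (pair_excess n A > c)) \<le> 27 * C ^ 4 / c" if "c > 0" for c n
    using pair_excess_tail[of ?p C c n] pb feller_prob_le CB p1 that by blast
  \<comment> \<open>\<open>M\<close> doubles the centring bound, as
    \<open>1 + L \<le> 2 * L\<close>. In \<open>S\<close>, \<open>12\<close> is \<open>4\<close>
    from \<open>(2 * L)\<^sup>2\<close> times \<open>3\<close> from \<open>s\<^sup>2\<close>.
    \<open>r\<close> satisfies \<open>L / s = r / sqrt L\<close>. In \<open>E\<close>,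
    \<open>5\<close> is \<open>4\<close> for \<open>2 * ln (1 + n)\<close> plus \<open>1\<close> for
    the coincidences; \<open>2 * D\<close> is the loss and \<open>M\<close> the centring.\<close>
  define M where "M = 2 * (B + 2 * \<theta>)"
  define S where "S = 12 * (B + C\<^sup>2 + 3 * \<theta>) / \<theta>"
  define r where "r = sqrt (3 / \<theta>)"
  define E where "E = 5 + 2 * D + M"
  have S0: "S \<ge> 0" "M \<ge> 0" "r > 0" "E \<ge> 0" using CB \<theta> D(1) by (auto simp: S_def M_def r_def E_def)
  \<comment> \<open>In order: Stein error, variance defect, Lipschitz cost of the pathwise error,
    probability of the bad events.\<close>
  define K where "K = 10 * r + 2 * S + E * r + (1 + 27 * C ^ 4)"
  define L0 where "L0 = max 1 (2 * S)"
  have "\<bar>ewens_prob \<theta> n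
        (\<lambda>\<sigma>. (ln (invol n (cycle_count n \<sigma>)) - \<theta> / 2 * (ln (real n))\<^sup>2) / sqrt (\<theta> / 3 * (ln (real n))^3) \<le> x)
      - Phi x\<bar> \<le> K / sqrt (ln (real n))" if Ln: "ln (real n) \<ge> L0" for n x
  proof -
    define L where "L = ln (real n)"
    define s where "s = sqrt (\<theta> / 3 * L^3)"
    define \<mu> where "\<mu> = (\<Sum>j=1..n. ?p j * ln (real j))"
    have L1: "L \<ge> 1" "2 * S \<le> L" using Ln by (auto simp: L_def L0_def)
    have n1: "n \<ge> 2"
    proof (rule ccontr)
      assume "\<not> n \<ge> 2"
      then have "n = 0 \<or> n = 1" by auto
      then show False using L1 by (auto simp: L_def)
    qed
    have s2: "s\<^sup>2 = \<theta> / 3 * L^3" and s0: "s > 0" using \<theta> L1 by (auto simp: s_def)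
    have Ls: "L / s = r / sqrt L"
    proof (rule power2_eq_imp_eq)
      show "(L / s)\<^sup>2 = (r / sqrt L)\<^sup>2"
        unfolding power_divide s2 r_def using L1 \<theta>
        by (simp add: power2_eq_square power3_eq_cube divide_simps)
    qed (use L1 s0 S0 in auto)
    have Lsqrt: "1 / L \<le> 1 / sqrt L"
    proof -
      have "sqrt L \<le> L" using L1 by (intro real_le_lsqrt) (auto simp: power2_eq_square)
      then show ?thesis using L1 by (intro divide_left_mono) auto
    qed
    have lnn: "ln (1 + real n) \<le> 2 * L"
    proof -
      have "1 + n \<le> n * n" using n1 by (induction n rule: dec_induct) auto
      then have "1 + real n \<le> real n * real n" by (metis of_nat_1 of_nat_add of_nat_le_iff of_nat_mult)
      then have "ln (1 + real n) \<le> ln (real n * real n)" using n1 by (subst ln_le_cancel_iff) auto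
      also have "\<dots> = 2 * L" using n1 by (simp add: ln_mult L_def)
      finally show ?thesis .
    qed
    have mean: "\<bar>\<mu> - \<theta> / 2 * L\<^sup>2\<bar> \<le> M * L"
    proof -
      have "\<bar>\<mu> - \<theta> / 2 * L\<^sup>2\<bar> \<le> (B + 2 * \<theta>) * (1 + L)"
        unfolding \<mu>_def L_def using n1 by (intro feller_mean) auto
      also have "\<dots> \<le> (B + 2 * \<theta>) * (2 * L)" using L1 CB \<theta> by (intro mult_left_mono) auto
      finally show ?thesis by (simp add: M_def algebra_simps)
    qed
    define V where "V = (\<Sum>j\<in>{1..n}. ?p j * (1 - ?p j) * (ln (real j) / s)\<^sup>2)"
    have V: "\<bar>V - 1\<bar> \<le> S / L"
    proof -
      have "V = (\<Sum>j=1..n. ?p j * (1 - ?p j) * (ln (real j))\<^sup>2) / s\<^sup>2"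
        unfolding V_def by (simp add: sum_divide_distrib power_divide)
      then have "V - 1 = ((\<Sum>j=1..n. ?p j * (1 - ?p j) * (ln (real j))\<^sup>2) - s\<^sup>2) / s\<^sup>2"
        using s0 by (simp only: diff_divide_distrib) simp
      then have "\<bar>V - 1\<bar> = \<bar>(\<Sum>j=1..n. ?p j * (1 - ?p j) * (ln (real j))\<^sup>2) - s\<^sup>2\<bar> / s\<^sup>2"
        by simp
      also have "\<dots> \<le> (B + C\<^sup>2 + 3 * \<theta>) * (1 + L)\<^sup>2 / s\<^sup>2"
      proof (rule divide_right_mono)
        show "\<bar>(\<Sum>j=1..n. ?p j * (1 - ?p j) * (ln (real j))\<^sup>2) - s\<^sup>2\<bar> \<le> (B + C\<^sup>2 + 3 * \<theta>) * (1 + L)\<^sup>2"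
          unfolding s2 L_def using n1 by (intro feller_variance) auto
      qed simp
      also have "\<dots> \<le> (B + C\<^sup>2 + 3 * \<theta>) * (2 * L)\<^sup>2 / s\<^sup>2"
        using L1 CB \<theta> by (intro divide_right_mono mult_left_mono power_mono) auto
      also have "\<dots> = S / L"
      proof -
        have "Q * (2 * L)\<^sup>2 / (\<theta> / 3 * L^3) = 12 * Q / \<theta> / L" for Q
          using L1 \<theta> by (simp add: power2_eq_square power3_eq_cube divide_simps)
        then show ?thesis unfolding s2 S_def .
      qed
      finally show ?thesis .
    qed
    have SL: "S / L \<le> 1 / 2" "S / L \<le> S / sqrt L"
      using L1 mult_left_mono[OF Lsqrt S0(1)] by (simp_all add: divide_le_eq)
    have be: "\<bar>bern_exp ?p {1..n} (\<lambda>A. of_bool (((\<Sum>j\<in>A. ln (real j)) - \<mu>) / s \<le> z)) - Phi z\<bar>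
        \<le> (10 * r + 2 * S) / sqrt L" for z
    proof -
      have eq: "((\<Sum>j\<in>A. ln (real j)) - \<mu>) / s = (\<Sum>j\<in>A. ln (real j) / s) - (\<Sum>j\<in>{1..n}. ?p j * (ln (real j) / s))" for A
        unfolding \<mu>_def by (simp add: diff_divide_distrib sum_divide_distrib)
      have "\<bar>bern_exp ?p {1..n} (\<lambda>A. of_bool (((\<Sum>j\<in>A. ln (real j)) - \<mu>) / s \<le> z)) - Phi z\<bar>
          \<le> 10 * (L / s) + 2 * \<bar>V - 1\<bar>"
        unfolding eq V_def
      proof (rule berry_esseen_bernoulli)
        show "0 \<le> ln (real j) / s \<and> ln (real j) / s \<le> L / s" if "j \<in> {1..n}" for j
          using that s0 by (auto simp: L_def intro!: divide_right_mono)
        show "\<bar>(\<Sum>j\<in>{1..n}. ?p j * (1 - ?p j) * (ln (real j) / s)\<^sup>2) - 1\<bar> \<le> 1 / 2"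
          using V SL unfolding V_def by linarith
      qed (use p01 L1 s0 in auto)
      also have "\<dots> \<le> 10 * (r / sqrt L) + 2 * (S / sqrt L)"
        unfolding Ls using order_trans[OF V SL(2)] by (intro add_mono mult_left_mono) auto
      finally show ?thesis by (simp add: add_divide_distrib)
    qed
    define T where "T = (\<lambda>A. ln (invol n (count (spacings n 0 A))))"
    \<comment> \<open>A sum of indicators, not a disjunction: linearity gives the union bound, and
      \<open>bad A < 1\<close> still excludes every bad event.\<close>
    define bad where "bad = (\<lambda>A. of_bool (1 \<notin> A) + of_bool (spacing_loss n 0 A > D * ln (1 + real n))
       + of_bool (pair_excess n A > L) :: real)"
    have bad_nonneg: "0 \<le> bad A" for A by (simp add: bad_def)
    have Ebad: "bern_exp ?p {1..n} bad \<le> (1 + 27 * C ^ 4) / sqrt L"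
    proof -
      have "bern_exp ?p {1..n} (\<lambda>A. of_bool (1 \<notin> A)) = 0"
        using bern_exp_condition[of "{1..n}" 1 ?p "\<lambda>A. of_bool (1 \<notin> A)"] n1 p1
        by (simp add: bern_exp_const)
      then have "bern_exp ?p {1..n} bad \<le> 0 + 1 / (1 + real n) + 27 * C ^ 4 / L"
        unfolding bad_def bern_exp_add using D(2)[of n] pair_tail[of L n] L1
        by (intro add_mono) auto
      also have "1 / (1 + real n) \<le> 1 / L"
        using L1 n1 ln_le_minus_one[of "real n"] by (intro divide_left_mono) (auto simp: L_def)
      also have "0 + 1 / L + 27 * C ^ 4 / L = (1 + 27 * C ^ 4) * (1 / L)" by (simp add: add_divide_distrib)
      also have "\<dots> \<le> (1 + 27 * C ^ 4) * (1 / sqrt L)" using Lsqrt CB by (intro mult_left_mono) auto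
      finally show ?thesis by simp
    qed
    define \<eta> where "\<eta> = E * (L / s)"
    have close: "\<bar>(T A - \<theta> / 2 * L\<^sup>2) / s - ((\<Sum>j\<in>A. ln (real j)) - \<mu>) / s\<bar> \<le> \<eta>"
      if "A \<subseteq> {1..n}" "bad A < 1" for A
    proof -
      have "\<not> 1 \<notin> A" "\<not> spacing_loss n 0 A > D * ln (1 + real n)" "\<not> pair_excess n A > L"
      proof -
        have "\<not> a \<and> \<not> b \<and> \<not> c" if "of_bool a + of_bool b + of_bool c < (1::real)" for a b c
          using that by (cases a; cases b; cases c) auto
        from this[OF that(2)[unfolded bad_def]]
        show "\<not> 1 \<notin> A" "\<not> spacing_loss n 0 A > D * ln (1 + real n)" "\<not> pair_excess n A > L"
          by blast+
      qed
      then have good: "1 \<in> A" "spacing_loss n 0 A \<le> D * ln (1 + real n)" "pair_excess n A \<le> L"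
        by auto
      have "\<bar>T A - (\<Sum>j\<in>A. ln (real j))\<bar> \<le> 2 * ln (1 + real n) + spacing_loss n 0 A + pair_excess n A"
        unfolding T_def using n1 good that(1) by (intro ln_invol_spacings) auto
      moreover have "D * ln (1 + real n) \<le> D * (2 * L)" using lnn D(1) by (intro mult_left_mono) auto
      moreover have "E * L = 4 * L + D * (2 * L) + L + M * L" by (simp add: E_def algebra_simps)
      ultimately have "\<bar>(T A - \<theta> / 2 * L\<^sup>2) - ((\<Sum>j\<in>A. ln (real j)) - \<mu>)\<bar> \<le> E * L"
        using mean lnn good by linarith
      then have "\<bar>(T A - \<theta> / 2 * L\<^sup>2) - ((\<Sum>j\<in>A. ln (real j)) - \<mu>)\<bar> / s \<le> E * L / s"
        using s0 by (intro divide_right_mono) auto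
      then show ?thesis using s0 by (simp add: \<eta>_def diff_divide_distrib[symmetric])
    qed
    \<comment> \<open>If \<open>b < 1\<close>, the values differ by at most \<open>\<eta>\<close>;
      otherwise the right-hand sides are at least \<open>1\<close>.\<close>
    have sandwich: "of_bool (u \<le> x) \<le> of_bool (v \<le> x + \<eta>) + b"
      "of_bool (v \<le> x - \<eta>) \<le> of_bool (u \<le> x) + b"
      if "b < 1 \<Longrightarrow> \<bar>u - v\<bar> \<le> \<eta>" "0 \<le> b" for u v b :: real
    proof (atomize(full), cases "b < 1")
      case True
      then have "u - v \<le> \<eta>" "v - u \<le> \<eta>" using that by linarith+
      then show "of_bool (u \<le> x) \<le> of_bool (v \<le> x + \<eta>) + b \<and> of_bool (v \<le> x - \<eta>) \<le> of_bool (u \<le> x) + b"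
        using that(2) by (simp add: of_bool_def)
    next
      case False
      then show "of_bool (u \<le> x) \<le> of_bool (v \<le> x + \<eta>) + b \<and> of_bool (v \<le> x - \<eta>) \<le> of_bool (u \<le> x) + b"
        by (simp add: of_bool_def)
    qed
    let ?T = "bern_exp ?p {1..n} (\<lambda>A. of_bool ((T A - \<theta> / 2 * L\<^sup>2) / s \<le> x))"
    let ?X = "\<lambda>z. bern_exp ?p {1..n} (\<lambda>A. of_bool (((\<Sum>j\<in>A. ln (real j)) - \<mu>) / s \<le> z))"
    have up: "?T \<le> ?X (x + \<eta>) + bern_exp ?p {1..n} bad"
      unfolding bern_exp_add[symmetric]
    proof (rule bern_exp_mono)
      fix A assume A: "A \<subseteq> {1..n}"
      show "of_bool ((T A - \<theta> / 2 * L\<^sup>2) / s \<le> x)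
          \<le> of_bool (((\<Sum>j\<in>A. ln (real j)) - \<mu>) / s \<le> x + \<eta>) + bad A"
        by (rule sandwich(1)[OF close[OF A] bad_nonneg])
    qed (use p01 in auto)
    have lo: "?X (x - \<eta>) \<le> ?T + bern_exp ?p {1..n} bad"
      unfolding bern_exp_add[symmetric]
    proof (rule bern_exp_mono)
      fix A assume A: "A \<subseteq> {1..n}"
      show "of_bool (((\<Sum>j\<in>A. ln (real j)) - \<mu>) / s \<le> x - \<eta>)
          \<le> of_bool ((T A - \<theta> / 2 * L\<^sup>2) / s \<le> x) + bad A"
        by (rule sandwich(2)[OF close[OF A] bad_nonneg])
    qed (use p01 in auto)
    have \<eta>: "\<eta> \<ge> 0" "\<eta> = E * r / sqrt L" using S0 L1 s0 Ls by (auto simp: \<eta>_def)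
    have "\<bar>?T - Phi x\<bar> \<le> (10 * r + 2 * S) / sqrt L + \<eta> + (1 + 27 * C ^ 4) / sqrt L"
      using up lo Ebad be[of "x + \<eta>"] be[of "x - \<eta>"] \<eta>(1)
        Phi_lipschitz[of "x + \<eta>" x] Phi_lipschitz[of "x - \<eta>" x] by linarith
    also have "\<dots> = K / sqrt L" unfolding \<eta>(2) K_def by (simp add: add_divide_distrib)
    finally show ?thesis
      unfolding ewens_prob_feller[OF \<theta>, where Q="\<lambda>c. (ln (invol n c) - _) / _ \<le> x"]
      by (simp add: T_def L_def s_def)
  qed
  then show ?thesis by (intro exI[of _ L0] exI[of _ K] conjI) (auto simp: L0_def)
qed

end

theorem theorem5p7:
  fixes \<theta> :: real
  assumes "\<theta> > 0"
  shows "(\<lambda>n::nat. SUP x::real. \<bar>ewens_prob \<theta> n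
            (\<lambda>\<sigma>. (ln (invol n (cycle_count n \<sigma>)) - \<theta> / 2 * (ln (real n))^2)
                   / sqrt (\<theta> / 3 * (ln (real n))^3) \<le> x) - Phi x\<bar>)
         \<in> O(\<lambda>n. 1 / sqrt (ln (real n)))"
proof -
  obtain L0 K where K: "L0 \<ge> 1" "\<And>n x. ln (real n) \<ge> L0 \<Longrightarrow>
     \<bar>ewens_prob \<theta> n
        (\<lambda>\<sigma>. (ln (invol n (cycle_count n \<sigma>)) - \<theta> / 2 * (ln (real n))\<^sup>2) / sqrt (\<theta> / 3 * (ln (real n))^3) \<le> x)
      - Phi x\<bar> \<le> K / sqrt (ln (real n))"
    using ewens_invol_berry_esseen[OF assms] by meson
  have "filterlim (\<lambda>n::nat. ln (real n)) at_top sequentially" by real_asymp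
  then have ev: "\<forall>\<^sub>F n in sequentially. ln (real n) \<ge> L0" by (simp add: filterlim_at_top)
  show ?thesis
  proof (rule bigoI[where c=K])
    show "\<forall>\<^sub>F n in sequentially. norm (SUP x::real. \<bar>ewens_prob \<theta> n
            (\<lambda>\<sigma>. (ln (invol n (cycle_count n \<sigma>)) - \<theta> / 2 * (ln (real n))^2)
                   / sqrt (\<theta> / 3 * (ln (real n))^3) \<le> x) - Phi x\<bar>)
         \<le> K * norm (1 / sqrt (ln (real n)))"
      using ev
    proof eventually_elim
      case (elim n)
      have "\<bar>SUP x::real. \<bar>ewens_prob \<theta> n
            (\<lambda>\<sigma>. (ln (invol n (cycle_count n \<sigma>)) - \<theta> / 2 * (ln (real n))^2)
                   / sqrt (\<theta> / 3 * (ln (real n))^3) \<le> x) - Phi x\<bar>\<bar> \<le> K / sqrt (ln (real n))"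
        \<comment> \<open>A real \<open>SUP\<close> is informative only for a bounded family; the
          uniform bound gives boundedness and the estimate at once.\<close>
        by (rule cSup_abs_le) (use K(2)[OF elim] in auto)
      then show ?case using K(1) elim by simp
    qed
  qed
qed

end
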